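(* Let $m,r\ge 2$ be integers. Let $F$ be an $r$-graph that either has at most $m$ vertices, or has exactly $m+1$ vertices one of which has degree $1$. If $\pi_\lambda(F)<\frac{[m]_r}{m^r}$, then $\mathcal{K}^F_{m+1}$ is $m$-stable.
   Context: An $r$-graph is a finite $r$-uniform hypergraph; $|G|$ denotes the number of edges and $n(G)$ the number of vertices of $G$. $F\subseteq G$ means $G$ contains a (not necessarily induced) copy of $F$ as a subgraph; $G$ is $F$-free if $F\not\subseteq G$, and is free of a family if it contains no member of the family. The degree of a vertex is the number of edges containing it. $[m]_r=m(m-1)\cdots(m-r+1)$ is the falling factorial. A pair of vertices is covered in a hypergraph if some edge contains both vertices. For an $r$-graph $F$ and an integer $p\ge n(F)$, $\mathcal{K}^F_p$ is the family of all $r$-graphs $H$ that contain a set $C$ of $p$ vertices (called the core) such that the subgraph $H[C]$ induced by $C$ contains a copy of $F$ and every pair of vertices in $C$ is covered in $H$. For an $r$-graph $G$ on $[t]=\{1,\dots,t\}$, let $p_G(x_1,\dots,x_t)=r!\sum_{e\in E(G)}\prod_{i\in e}x_i$. The Lagrangian of $G$ is $\lambda(G)=\max\{p_G(x): x_i\ge 0\ \forall i,\ \sum_i x_i=1\}$. The Lagrangian density of an $r$-graph $F$ is $\pi_\lambda(F)=\sup\{\lambda(G): G \text{ an } r\text{-graph with } F\not\subseteq G\}$. An $r$-graph is $m$-partite if its vertex set can be partitioned into $m$ parts (possibly empty) such that every edge contains at most one vertex of each part. For integers $m,r\ge2$ and an $r$-graph $F$ on at most $m+1$ vertices with $\pi_\lambda(F)\le\frac{[m]_r}{m^r}$,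 the family $\mathcal{K}^F_{m+1}$ is called $m$-stable if for every real $\varepsilon>0$ there are a real $\delta_1>0$ and an integer $n_1$ such that every $\mathcal{K}^F_{m+1}$-free $r$-graph $G$ with $n\ge n_1$ vertices and more than $\left(\frac{[m]_r}{m^r}-\delta_1\right)\binom{n}{r}$ edges can be made $m$-partite by deleting at most $\varepsilon n$ vertices. *)

theory Defs
  imports Complex_Main "HOL-Library.Disjoint_Sets"
begin

datatype 'a hypergraph = Hypergraph (vertices: "'a set") (edges: "'a set set")

definition r_graph :: "nat \<Rightarrow> 'a hypergraph \<Rightarrow> bool" where
  "r_graph r G \<longleftrightarrow> finite (vertices G) \<and> (\<forall>e\<in>edges G. e \<subseteq> vertices G \<and> card e = r)"

definition contains_copy :: "'b hypergraph \<Rightarrow> 'a hypergraph \<Rightarrow> bool" where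
  "contains_copy G F \<longleftrightarrow>
     (\<exists>f. inj_on f (vertices F) \<and> f ` vertices F \<subseteq> vertices G \<and> (\<forall>e\<in>edges F. f ` e \<in> edges G))"

definition family_free :: "'a hypergraph set \<Rightarrow> 'b hypergraph \<Rightarrow> bool" where
  "family_free \<H> G \<longleftrightarrow> (\<forall>H\<in>\<H>. \<not> contains_copy G H)"

definition induced :: "'a hypergraph \<Rightarrow> 'a set \<Rightarrow> 'a hypergraph" where
  "induced G C = Hypergraph (vertices G \<inter> C) {e \<in> edges G. e \<subseteq> C}"

definition degree :: "'a hypergraph \<Rightarrow> 'a \<Rightarrow> nat" where
  "degree G v = card {e \<in> edges G. v \<in> e}"

definition covered :: "'a hypergraph \<Rightarrow> 'a \<Rightarrow> 'a \<Rightarrow> bool" where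
  "covered H u v \<longleftrightarrow> (\<exists>e\<in>edges H. u \<in> e \<and> v \<in> e)"

definition K_family :: "nat \<Rightarrow> 'a hypergraph \<Rightarrow> nat \<Rightarrow> 'b hypergraph set" where
  "K_family r F p =
     {H. r_graph r H \<and>
         (\<exists>C. C \<subseteq> vertices H \<and> card C = p \<and> contains_copy (induced H C) F \<and>
              (\<forall>u\<in>C. \<forall>v\<in>C. u \<noteq> v \<longrightarrow> covered H u v))}"

definition lagrange_poly :: "nat \<Rightarrow> 'a hypergraph \<Rightarrow> ('a \<Rightarrow> real) \<Rightarrow> real" where
  "lagrange_poly r G x = fact r * (\<Sum>e\<in>edges G. \<Prod>i\<in>e. x i)"

text \<open>The supremum is a maximum when the vertex set is nonempty, since the simplex is compact.
  On the empty vertex set the simplex is empty and the value is meaningless.\<close>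

definition lagrangian :: "nat \<Rightarrow> 'a hypergraph \<Rightarrow> real" where
  "lagrangian r G =
     Sup {lagrange_poly r G x | x. (\<forall>i\<in>vertices G. 0 \<le> x i) \<and> (\<Sum>i\<in>vertices G. x i) = 1}"

text \<open>Every finite hypergraph is isomorphic to one with natural numbers as vertices, so letting
  \<open>G\<close> range over \<open>nat hypergraph\<close> loses nothing. Lagrangians are nonnegative, and a single
  vertex without edges has Lagrangian \<open>0\<close> (for \<open>r \<ge> 2\<close>), so inserting \<open>0\<close> matters only if \<open>F\<close>
  has at most one vertex: then there is no nonempty \<open>F\<close>-free hypergraph and the supremum over the
  empty subset of \<open>[0, \<infinity>)\<close> is read as \<open>0\<close>.\<close>

definition lagrangian_density :: "nat \<Rightarrow> 'a hypergraph \<Rightarrow> real" where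
  "lagrangian_density r F =
     Sup (insert 0 {lagrangian r G | G :: nat hypergraph.
                      r_graph r G \<and> vertices G \<noteq> {} \<and> \<not> contains_copy G F})"

definition m_partite :: "nat \<Rightarrow> 'a hypergraph \<Rightarrow> bool" where
  "m_partite m G \<longleftrightarrow>
     (\<exists>P :: nat \<Rightarrow> 'a set. disjoint_family_on P {..<m} \<and> (\<Union>i<m. P i) = vertices G \<and>
        (\<forall>e\<in>edges G. \<forall>i<m. card (e \<inter> P i) \<le> 1))"

definition delete_vertices :: "'a hypergraph \<Rightarrow> 'a set \<Rightarrow> 'a hypergraph" where
  "delete_vertices G S = induced G (vertices G - S)"

definition falling_factorial :: "nat \<Rightarrow> nat \<Rightarrow> real" where
  "falling_factorial m r = (\<Prod>i<r. real m - real i)"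

text \<open>The conditions on \<open>m\<close>, \<open>r\<close>, \<open>F\<close> under which the notion is used for \<open>K_family r F (m + 1)\<close>
  (\<open>m, r \<ge> 2\<close>, at most \<open>m + 1\<close> vertices in \<open>F\<close>, \<open>lagrangian_density r F\<close> at most
  \<open>falling_factorial m r / m ^ r\<close>) are not part of the predicate.\<close>

definition m_stable :: "nat \<Rightarrow> nat \<Rightarrow> 'a hypergraph set \<Rightarrow> bool" where
  "m_stable r m \<H> \<longleftrightarrow>
     (\<forall>\<epsilon>::real. \<epsilon> > 0 \<longrightarrow>
       (\<exists>\<delta>::real. \<delta> > 0 \<and>
         (\<exists>n\<^sub>1::nat. \<forall>G :: nat hypergraph.
            r_graph r G \<and> family_free \<H> G \<and> card (vertices G) \<ge> n\<^sub>1 \<and>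
            real (card (edges G)) >
              (falling_factorial m r / real m ^ r - \<delta>) * real (card (vertices G) choose r) \<longrightarrow>
            (\<exists>S. S \<subseteq> vertices G \<and> real (card S) \<le> \<epsilon> * real (card (vertices G)) \<and>
                 m_partite m (delete_vertices G S)))))"

end

theory Submission
  imports Defs "HOL-Library.Ramsey"
begin

text \<open>
  Because a \<open>\<K>\<close>-free hypergraph \<open>G\<close> is itself a candidate member of the family, freeness just says
  that \<open>G\<close> has no pairwise covered set of \<open>m + 1\<close> vertices inducing a copy of \<open>F\<close>. Instead of
  symmetrizing \<open>G\<close>, keep \<open>G\<close> fixed and move vertex weights: the Lagrange polynomial is linear in
  weight moved between two uncovered vertices, so weight can be moved without loss until the
  support is pairwise covered. Then either the support has at most \<open>m\<close> vertices, or it induces an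
  \<open>F\<close>-free hypergraph and the value is at most \<open>\<pi>\<^sub>\<lambda>(F)\<close>. This bounds the polynomial by
  \<open>\<mu> = [m]\<^sub>r / m\<^sup>r\<close>. For stability start from uniform weights with value near \<open>\<mu>\<close>, and trace the
  motion back from an end where the support has at most \<open>m\<close> vertices. In each small step the weight
  of the set to be deleted grows slightly, but it can be reset to the set of low-degree vertices,
  whose weight is small a priori, because a vertex of high degree can always be added to an
  \<open>m\<close>-partite part of almost full weight.
\<close>

subsection \<open>Weights of set families\<close>

text \<open>Why a vertex \<open>v\<close> of high degree fits into an \<open>m\<close>-partite part:
  if \<open>v\<close> had neighbours in all \<open>m\<close> parts, near-extremality would yield one
  neighbour in each part such that these \<open>m\<close> vertices span a complete
  \<open>r\<close>-graph and \<open>v\<close> forms an edge with \<open>r - 1\<close> of them. All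
  of \<open>F\<close> but a vertex of degree 1 embeds in the complete \<open>r\<close>-graph, with
  freedom to send the one remaining edge to that edge of \<open>v\<close>, so this would be a
  forbidden core. Hence some part contains no neighbour of \<open>v\<close> and can receive it. The
  obstacle is a part in which the neighbours of \<open>v\<close> have almost no weight, so that
  counting cannot select a vertex there. At most one part is of this kind; a neighbour
  \<open>u\<close> in it is fixed beforehand, and the high degree of \<open>u\<close> itself
  controls the choice in the other parts. The strict inequality in the hypothesis on the Lagrangian
  density leaves a gap: weights of value close to \<mu> cannot be supported on a pairwise covered
  set of more than \<open>m\<close> vertices.\<close>

definition wt :: "('a \<Rightarrow> real) \<Rightarrow> 'a set set \<Rightarrow> real" where
  "wt x \<E> = (\<Sum>e\<in>\<E>. \<Prod>i\<in>e. x i)"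

text \<open>For a finite family of finite sets, \<open>wt x (link \<E> v)\<close> is the partial
  derivative of \<open>wt x \<E>\<close> in the coordinate \<open>x v\<close>: a weighted degree of
  \<open>v\<close>.\<close>

definition link :: "'a set set \<Rightarrow> 'a \<Rightarrow> 'a set set" where
  "link \<E> v = {f. v \<notin> f \<and> insert v f \<in> \<E>}"

lemma finite_link: "finite \<E> \<Longrightarrow> finite (link \<E> v)"
  by (rule finite_subset[of _ "(\<lambda>e. e - {v}) ` \<E>"]) (auto simp: link_def image_iff intro!: bexI[of _ "insert v _"])

lemma wt_nonneg: "(\<And>i. 0 \<le> x i) \<Longrightarrow> 0 \<le> wt x \<E>"
  unfolding wt_def by (intro sum_nonneg prod_nonneg) auto

lemma wt_mono: "finite \<F> \<Longrightarrow> \<E> \<subseteq> \<F> \<Longrightarrow> (\<And>i. 0 \<le> x i) \<Longrightarrow> wt x \<E> \<le> wt x \<F>"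
  unfolding wt_def by (intro sum_mono2 prod_nonneg) auto

lemma wt_cong: "(\<And>e i. e \<in> \<E> \<Longrightarrow> i \<in> e \<Longrightarrow> x i = y i) \<Longrightarrow> wt x \<E> = wt y \<E>"
  unfolding wt_def by (intro sum.cong prod.cong) auto

lemma wt_Un_disjoint:
  "finite A \<Longrightarrow> finite B \<Longrightarrow> A \<inter> B = {} \<Longrightarrow> wt x (A \<union> B) = wt x A + wt x B"
  by (simp add: wt_def sum.union_disjoint)

lemma link_image: "insert v ` link \<E> v = {e \<in> \<E>. v \<in> e}"
proof -
  have "e \<in> insert v ` link \<E> v" if "e \<in> \<E>" "v \<in> e" for e
    using that by (intro image_eqI[of _ _ "e - {v}"]) (auto simp: link_def insert_absorb)
  then show ?thesis by (auto simp: link_def)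
qed

lemma wt_star:
  assumes "\<And>e. e \<in> \<E> \<Longrightarrow> finite e"
  shows "wt x {e \<in> \<E>. v \<in> e} = x v * wt x (link \<E> v)"
proof -
  have inj: "inj_on (insert v) (link \<E> v)"
    by (auto simp: inj_on_def link_def)
  have "wt x {e \<in> \<E>. v \<in> e} = (\<Sum>f\<in>link \<E> v. \<Prod>i\<in>insert v f. x i)"
    unfolding wt_def link_image[symmetric] using inj by (simp add: sum.reindex)
  also have "\<dots> = (\<Sum>f\<in>link \<E> v. x v * (\<Prod>i\<in>f. x i))"
    using assms by (intro sum.cong) (auto simp: link_def intro!: prod.insert dest!: assms)
  finally show ?thesis by (simp add: wt_def sum_distrib_left)
qed

lemma wt_split:
  assumes "finite \<E>" "\<And>e. e \<in> \<E> \<Longrightarrow> finite e"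
  shows "wt x \<E> = x v * wt x (link \<E> v) + wt x {e \<in> \<E>. v \<notin> e}"
proof -
  have "wt x ({e \<in> \<E>. v \<in> e} \<union> {e \<in> \<E>. v \<notin> e}) = wt x {e \<in> \<E>. v \<in> e} + wt x {e \<in> \<E>. v \<notin> e}"
    using assms(1) by (intro wt_Un_disjoint) auto
  moreover have "{e \<in> \<E>. v \<in> e} \<union> {e \<in> \<E>. v \<notin> e} = \<E>" by auto
  ultimately show ?thesis using wt_star[OF assms(2)] by simp
qed

text \<open>Euler's identity for a homogeneous polynomial of degree \<open>r\<close>: every edge is
  counted once at each of its \<open>r\<close> vertices.\<close>

lemma handshake:
  assumes "finite V" "\<And>e. e \<in> \<E> \<Longrightarrow> e \<subseteq> V \<and> card e = r"
  shows "(\<Sum>v\<in>V. x v * wt x (link \<E> v)) = real r * wt x \<E>"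
proof -
  have fin: "finite e" if "e \<in> \<E>" for e
    using assms that finite_subset by metis
  have finE: "finite \<E>"
    using assms by (intro finite_subset[of \<E> "Pow V"]) auto
  have "(\<Sum>v\<in>V. x v * wt x (link \<E> v)) = (\<Sum>v\<in>V. \<Sum>e | e \<in> \<E> \<and> v \<in> e. \<Prod>i\<in>e. x i)"
    using wt_star[OF fin] by (simp add: wt_def)
  also have "\<dots> = (\<Sum>e\<in>\<E>. \<Sum>v | v \<in> V \<and> v \<in> e. \<Prod>i\<in>e. x i)"
    by (rule sum.swap_restrict) (use assms finE in auto)
  also have "\<dots> = (\<Sum>e\<in>\<E>. real r * (\<Prod>i\<in>e. x i))"
  proof (intro sum.cong refl)
    fix e assume "e \<in> \<E>"
    with assms(2) have "{v. v \<in> V \<and> v \<in> e} = e" "card e = r" by auto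
    then show "(\<Sum>v | v \<in> V \<and> v \<in> e. \<Prod>i\<in>e. x i) = real r * (\<Prod>i\<in>e. x i)" by simp
  qed
  finally show ?thesis by (simp add: wt_def sum_distrib_left)
qed

section \<open>Elementary symmetric polynomials, as weights of complete set families\<close>

lemma nsets_insert:
  assumes "a \<notin> J"
  shows "link (nsets (insert a J) (Suc q)) a = nsets J q"
    and "{e \<in> nsets (insert a J) q. a \<notin> e} = nsets J q"
proof -
  show "link (nsets (insert a J) (Suc q)) a = nsets J q"
    using assms by (auto simp: link_def nsets_def card_insert_if)
  show "{e \<in> nsets (insert a J) q. a \<notin> e} = nsets J q"
    using assms by (auto simp: nsets_def)
qed

lemma wt_nsets_insert:
  assumes "a \<notin> J" "finite J"
  shows "wt w (nsets (insert a J) (Suc q)) = w a * wt w (nsets J q) + wt w (nsets J (Suc q))"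
proof -
  have "wt w (nsets (insert a J) (Suc q)) = w a * wt w (link (nsets (insert a J) (Suc q)) a)
      + wt w {e \<in> nsets (insert a J) (Suc q). a \<notin> e}"
    using assms by (intro wt_split) (auto simp: finite_imp_finite_nsets nsets_def)
  with assms show ?thesis by (simp add: nsets_insert)
qed

lemma wt_singleton_empty [simp]: "wt w {{}} = 1"
  by (simp add: wt_def)

lemma wt_nsets_le_power:
  assumes "finite J" "\<And>i. 0 \<le> w i"
  shows "wt w (nsets J q) \<le> sum w J ^ q"
  using assms(1)
proof (induction J arbitrary: q)
  case empty
  then show ?case by (simp add: nsets_empty_iff wt_def)
next
  case (insert a J)
  let ?s = "sum w J"
  have s: "0 \<le> ?s" using assms by (simp add: sum_nonneg)
  show ?case
  proof (cases q)
    case (Suc p)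
    have "wt w (nsets (insert a J) q) = w a * wt w (nsets J p) + wt w (nsets J (Suc p))"
      using insert Suc by (simp add: wt_nsets_insert)
    also have "\<dots> \<le> w a * ?s ^ p + ?s * ?s ^ p"
      using insert.IH[of p] insert.IH[of "Suc p"] assms(2) by (intro add_mono mult_left_mono) auto
    also have "\<dots> = (w a + ?s) * ?s ^ p" by (simp add: algebra_simps)
    also have "\<dots> \<le> (w a + ?s) * (w a + ?s) ^ p"
      using s assms(2) by (intro mult_left_mono power_mono) auto
    finally show ?thesis using insert Suc by simp
  qed simp
qed

lemma wt_nsets_le_1:
  assumes "finite J" "\<And>i. 0 \<le> w i" "sum w J \<le> 1"
  shows "wt w (nsets J q) \<le> 1"
  using wt_nsets_le_power[of J w q] power_le_one[of "sum w J" q] assms by (simp add: sum_nonneg)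

lemma wt_le_1:
  assumes "finite J" "\<And>i. 0 \<le> w i" "sum w J \<le> 1" "\<And>e. e \<in> \<E> \<Longrightarrow> e \<subseteq> J \<and> card e = q"
  shows "wt w \<E> \<le> 1"
proof -
  have "wt w \<E> \<le> wt w (nsets J q)"
    using assms by (intro wt_mono finite_imp_finite_nsets) (auto simp: nsets_def dest: finite_subset[OF _ assms(1)])
  then show ?thesis using wt_nsets_le_1[OF assms(1-3)] by (meson order_trans)
qed

text \<open>An elementary symmetric polynomial depends on two chosen coordinates only through their
  sum and their product, and the product has a nonnegative coefficient.\<close>

lemma wt_nsets_smooth:
  assumes J: "finite J" "i \<notin> J" "j \<notin> J" "i \<noteq> j"
    and w: "\<And>k. 0 \<le> w k" and sum: "a + b = w i + w j" and prod: "w i * w j \<le> a * b"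
  shows "wt w (nsets (insert i (insert j J)) q) \<le> wt (w(i := a, j := b)) (nsets (insert i (insert j J)) q)"
proof -
  let ?w = "w(i := a, j := b)"
  have same: "wt ?w (nsets J p) = wt w (nsets J p)" for p
    using J by (intro wt_cong) (auto simp: nsets_def)
  consider "q = 0" | "q = 1" | p where "q = Suc (Suc p)"
    by (metis One_nat_def not0_implies_Suc)
  then show ?thesis
  proof cases
    case 2
    have "wt u (nsets (insert i (insert j J)) (Suc 0)) = u i + (u j + wt u (nsets J (Suc 0)))" for u
      using J by (simp add: wt_nsets_insert)
    with 2 same J sum show ?thesis by simp
  next
    case 3
    have *: "wt u (nsets (insert i (insert j J)) q)
        = u i * u j * wt u (nsets J p) + (u i + u j) * wt u (nsets J (Suc p)) + wt u (nsets J q)" for u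
      using J 3 by (simp add: wt_nsets_insert algebra_simps)
    have "w i * w j * wt w (nsets J p) \<le> a * b * wt w (nsets J p)"
      using prod w by (intro mult_right_mono wt_nonneg)
    with sum J show ?thesis unfolding * same by simp
  qed simp
qed

lemma wt_nsets_const:
  assumes "finite J" "\<And>i. i \<in> J \<Longrightarrow> w i = c"
  shows "wt w (nsets J q) = real (card J choose q) * c ^ q"
proof -
  have "wt w (nsets J q) = (\<Sum>e\<in>nsets J q. c ^ q)"
    unfolding wt_def
  proof (intro sum.cong refl)
    fix e assume "e \<in> nsets J q"
    then have e: "e \<subseteq> J" "card e = q" by (auto simp: nsets_def)
    then have "prod w e = (\<Prod>i\<in>e. c)" using assms by (intro prod.cong) auto
    with e show "prod w e = c ^ q" by simp
  qed
  moreover have "card (nsets J q) = card J choose q"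
    using n_subsets[OF assms(1), of q] by (simp add: nsets_def) (metis (mono_tags, lifting) Collect_cong assms(1) finite_subset)
  ultimately show ?thesis by simp
qed

text \<open>Smoothing: moving a pair of coordinates on either side of the mean \<open>c\<close> so that one of them
  becomes \<open>c\<close> increases their product and leaves their sum unchanged.\<close>
lemma maclaurin:
  assumes "finite J" "\<And>i. 0 \<le> w i" "sum w J = real (card J) * c"
  shows "wt w (nsets J q) \<le> real (card J choose q) * c ^ q"
  using assms(2,3)
\<comment> \<open>The smoothing step puts \<open>i\<close> at the mean, and \<open>j\<close> was off
  the mean already, so the number of coordinates off the mean drops even if \<open>j\<close> stays
  off.\<close>
proof (induction "card {i \<in> J. w i \<noteq> c}" arbitrary: w rule: less_induct)
  case less
  show ?case
  proof (cases "\<exists>i\<in>J. w i \<noteq> c")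
    case False
    then show ?thesis using wt_nsets_const[OF assms(1), of w c] by auto
  next
    case True
    have "\<exists>i\<in>J. w i < c"
    proof (rule ccontr)
      assume "\<not> ?thesis"
      then have ge: "\<forall>i\<in>J. c \<le> w i" by (auto simp: not_less)
      with True have "\<exists>i\<in>J. c < w i" by (metis order_le_imp_less_or_eq)
      with ge have "(\<Sum>i\<in>J. c) < sum w J"
        using assms(1) by (intro sum_strict_mono_ex1) auto
      with less.prems(2) show False by simp
    qed
    then obtain i where i: "i \<in> J" "w i < c" by blast
    have "\<exists>j\<in>J. c < w j"
    proof (rule ccontr)
      assume "\<not> ?thesis"
      then have le: "\<forall>i\<in>J. w i \<le> c" by (auto simp: not_less)
      with True have "\<exists>i\<in>J. w i < c" by (metis order_le_imp_less_or_eq)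
      with le have "sum w J < (\<Sum>i\<in>J. c)"
        using assms(1) by (intro sum_strict_mono_ex1) auto
      with less.prems(2) show False by simp
    qed
    then obtain j where j: "j \<in> J" "c < w j" by blast
    define J' where "J' = J - {i, j}"
    have J': "J = insert i (insert j J')" "i \<notin> J'" "j \<notin> J'" "i \<noteq> j" "finite J'"
      using i j assms(1) by (auto simp: J'_def)
    let ?w = "w(i := c, j := w i + w j - c)"
    have "w i * w j \<le> c * (w i + w j - c)"
    proof -
      have "0 \<le> (c - w i) * (w j - c)" using i j by simp
      then show ?thesis by (simp add: algebra_simps)
    qed
    then have "wt w (nsets J q) \<le> wt ?w (nsets J q)"
      unfolding J'(1) using J' less.prems(1) by (intro wt_nsets_smooth) auto
    also have "\<dots> \<le> real (card J choose q) * c ^ q"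
    proof (rule less.hyps)
      have "{k \<in> J. ?w k \<noteq> c} \<subset> {k \<in> J. w k \<noteq> c}"
      proof
        show "{k \<in> J. ?w k \<noteq> c} \<subseteq> {k \<in> J. w k \<noteq> c}" using i j by auto
        have "i \<in> {k \<in> J. w k \<noteq> c}" "i \<notin> {k \<in> J. ?w k \<noteq> c}" using i J'(4) by auto
        then show "{k \<in> J. ?w k \<noteq> c} \<noteq> {k \<in> J. w k \<noteq> c}" by metis
      qed
      then show "card {k \<in> J. ?w k \<noteq> c} < card {k \<in> J. w k \<noteq> c}"
        using assms(1) by (intro psubset_card_mono) auto
      show "0 \<le> ?w k" for k using less.prems(1)[of k] less.prems(1)[of i] i j by auto
      have "sum ?w J' = sum w J'" using J' by (intro sum.cong) auto
      then show "sum ?w J = real (card J) * c"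
        using less.prems(2) J' by (simp)
    qed
    finally show ?thesis .
  qed
qed

subsection \<open>Weighted symmetrization\<close>

text \<open>For positive \<open>m\<close> this is the Lagrangian of the complete
  \<open>r\<close>-graph on \<open>m\<close> vertices, attained at uniform weights.\<close>

definition turan_density :: "nat \<Rightarrow> nat \<Rightarrow> real" where
  "turan_density m r = falling_factorial m r / real m ^ r"

lemma falling_factorial_choose: "falling_factorial m r = fact r * real (m choose r)"
  by (simp add: falling_factorial_def binomial_gbinomial gbinomial_prod_rev atLeast0LessThan)

lemma turan_density_choose: "real (m choose r) * (1 / real m) ^ r = turan_density m r / fact r"
  by (simp add: turan_density_def falling_factorial_choose field_simps)

lemma turan_density_prod: "turan_density m r = (\<Prod>i<r. (real m - real i) / real m)"
  by (simp add: turan_density_def falling_factorial_def prod_dividef)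

lemma turan_density_nonneg: "0 \<le> turan_density m r"
  by (simp add: turan_density_def falling_factorial_choose)

lemma turan_density_eq_0: "s < r \<Longrightarrow> turan_density s r = 0"
  by (simp add: turan_density_def falling_factorial_choose binomial_eq_0)

lemma turan_density_le_1: "turan_density m r \<le> 1"
proof (cases "r \<le> m")
  case True
  then show ?thesis unfolding turan_density_prod
    by (intro prod_le_1) (auto simp: divide_simps)
qed (simp add: turan_density_eq_0)

lemma turan_density_pos: "r \<le> m \<Longrightarrow> 0 < turan_density m r"
  unfolding turan_density_prod by (intro prod_pos) auto

lemma turan_density_mono:
  assumes "s \<le> m" shows "turan_density s r \<le> turan_density m r"
proof (cases "s < r")
  case True then show ?thesis by (simp add: turan_density_eq_0 turan_density_nonneg)
next
  case False
  with assms show ?thesis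
    unfolding turan_density_prod by (intro prod_mono) (auto simp: field_simps intro!: mult_left_mono)
qed

lemma turan_density_strict_mono:
  assumes "s < m" "r \<le> m" "2 \<le> r"
  shows "turan_density s r < turan_density m r"
proof (cases "s < r")
  case True then show ?thesis using turan_density_pos assms by (simp add: turan_density_eq_0)
next
  case False
  \<comment> \<open>The factor for \<open>i = 0\<close> is \<open>1\<close> on both sides; the
    factor for \<open>i = 1\<close>, present because \<open>2 \<le> r\<close>, already grows
    strictly.\<close>
  with assms show ?thesis
    unfolding turan_density_prod
    by (intro prod_mono_strict[of 1]) (auto simp: field_simps intro!: mult_left_mono)
qed

section \<open>Effect of moving and lowering weights\<close>

lemma wt_le_fun: "(\<And>i. 0 \<le> y i) \<Longrightarrow> (\<And>i. y i \<le> x i) \<Longrightarrow> wt y \<E> \<le> wt x \<E>"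
  unfolding wt_def by (intro sum_mono prod_mono) auto

lemma wt_shift:
  assumes fin: "finite \<E>" "\<And>e. e \<in> \<E> \<Longrightarrow> finite e"
    and uv: "u \<noteq> v" "\<And>e. e \<in> \<E> \<Longrightarrow> \<not> (u \<in> e \<and> v \<in> e)"
  shows "wt (x(u := x u + t, v := x v - t)) \<E> = wt x \<E> + t * (wt x (link \<E> u) - wt x (link \<E> v))"
proof -
  have *: "wt y \<E> = y u * wt x (link \<E> u) + (y v * wt x (link \<E> v) + wt x {e \<in> \<E>. u \<notin> e \<and> v \<notin> e})"
    if "\<And>i. i \<noteq> u \<Longrightarrow> i \<noteq> v \<Longrightarrow> y i = x i" for y
  proof -
    have "wt y \<E> = y u * wt y (link \<E> u) + wt y {e \<in> \<E>. u \<notin> e}"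
      using fin by (rule wt_split)
    also have "wt y {e \<in> \<E>. u \<notin> e} = y v * wt y (link {e \<in> \<E>. u \<notin> e} v)
        + wt y {e \<in> {e \<in> \<E>. u \<notin> e}. v \<notin> e}"
      using fin by (intro wt_split) auto
    also have "link {e \<in> \<E>. u \<notin> e} v = link \<E> v"
      using uv by (auto simp: link_def)
    also have "{e \<in> {e \<in> \<E>. u \<notin> e}. v \<notin> e} = {e \<in> \<E>. u \<notin> e \<and> v \<notin> e}" by auto
    also have "wt y {e \<in> \<E>. u \<notin> e \<and> v \<notin> e} = wt x {e \<in> \<E>. u \<notin> e \<and> v \<notin> e}"
      by (rule wt_cong, rule that) auto
    also have "wt y (link \<E> u) = wt x (link \<E> u)"
      by (rule wt_cong, rule that) (use uv in \<open>auto simp: link_def\<close>)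
    also have "wt y (link \<E> v) = wt x (link \<E> v)"
      by (rule wt_cong, rule that) (use uv in \<open>auto simp: link_def\<close>)
    finally show ?thesis .
  qed
  show ?thesis using uv by (subst (1 2) *) (auto simp: algebra_simps)
qed

text \<open>Lowering one coordinate at a time costs exactly the decrement times the current link
  weight, and link weights are largest at \<open>x\<close>.\<close>

lemma wt_decrease:
  assumes fin: "finite \<E>" "\<And>e. e \<in> \<E> \<Longrightarrow> finite e" and "finite Z"
    and "\<And>i. 0 \<le> y i" "\<And>i. y i \<le> x i" "\<And>i. i \<notin> Z \<Longrightarrow> y i = x i"
  shows "wt x \<E> \<le> wt y \<E> + (\<Sum>v\<in>Z. (x v - y v) * wt x (link \<E> v))"
  using assms(3-)
proof (induction Z arbitrary: y)
  case empty
  then have "x = y" by auto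
  then show ?case by simp
next
  case (insert a Z)
  let ?y = "y(a := x a)"
  have x0: "0 \<le> x i" for i using insert.prems(1,2)[of i] by simp
  have "wt x \<E> \<le> wt ?y \<E> + (\<Sum>v\<in>Z. (x v - ?y v) * wt x (link \<E> v))"
    using insert.prems x0 by (intro insert.IH) auto
  also have "(\<Sum>v\<in>Z. (x v - ?y v) * wt x (link \<E> v)) = (\<Sum>v\<in>Z. (x v - y v) * wt x (link \<E> v))"
    using insert.hyps by (intro sum.cong) auto
  also have "wt ?y \<E> = wt y \<E> + (x a - y a) * wt y (link \<E> a)"
  proof -
    have "wt ?y \<E> = ?y a * wt ?y (link \<E> a) + wt ?y {e \<in> \<E>. a \<notin> e}" using fin by (rule wt_split)
    also have "wt ?y (link \<E> a) = wt y (link \<E> a)" by (rule wt_cong) (auto simp: link_def)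
    also have "wt ?y {e \<in> \<E>. a \<notin> e} = wt y {e \<in> \<E>. a \<notin> e}" by (rule wt_cong) auto
    finally show ?thesis using wt_split[OF fin, of y a] by (simp add: algebra_simps fun_upd_def)
  qed
  finally have "wt x \<E> \<le> wt y \<E> + (x a - y a) * wt y (link \<E> a) + (\<Sum>v\<in>Z. (x v - y v) * wt x (link \<E> v))" .
  moreover have "(x a - y a) * wt y (link \<E> a) \<le> (x a - y a) * wt x (link \<E> a)"
    using insert.prems by (intro mult_left_mono wt_le_fun) auto
  ultimately show ?case using insert.hyps by simp
qed

text \<open>Crude in the quadratic term but exact in the linear one, which has to cancel in
  \<open>low_degree_weight\<close>.\<close>

lemma power_le_quadratic:
  fixes t :: real
  assumes "0 \<le> t" "t \<le> 1"
  shows "(1 - t) ^ r \<le> 1 - real r * t + real r ^ 2 * t ^ 2"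
proof (induction r)
  case (Suc r)
  have "(1 - t) ^ Suc r \<le> (1 - t) * (1 - real r * t + real r ^ 2 * t ^ 2)"
    using Suc assms by (simp add: mult_left_mono)
  also have "\<dots> = 1 - real (Suc r) * t + (real r + real r ^ 2) * t ^ 2 - real r ^ 2 * t ^ 3"
    by (simp add: algebra_simps power2_eq_square power3_eq_cube)
  also have "\<dots> \<le> 1 - real (Suc r) * t + (real (Suc r) ^ 2) * t ^ 2"
  proof -
    have "(real r + real r ^ 2) * t ^ 2 \<le> (real (Suc r) ^ 2) * t ^ 2"
      by (intro mult_right_mono) (auto simp: power2_eq_square algebra_simps)
    moreover have "0 \<le> real r ^ 2 * t ^ 3" using assms by simp
    ultimately show ?thesis by linarith
  qed
  finally show ?case .
qed simp

definition pairwise_covered :: "'a set set \<Rightarrow> 'a set \<Rightarrow> bool" where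
  "pairwise_covered \<E> S \<longleftrightarrow> (\<forall>u\<in>S. \<forall>v\<in>S. u \<noteq> v \<longrightarrow> (\<exists>e\<in>\<E>. u \<in> e \<and> v \<in> e))"

text \<open>What is used of a \<open>\<K>\<close>-free hypergraph. In \<open>no_core\<close> the vertex \<open>y\<close> with its edge into
  the complete set \<open>U\<close> can serve as the vertex of degree \<open>1\<close> of \<open>F\<close>. The number \<open>\<rho>\<close> in \<open>sparse\<close> stands
  for \<open>\<pi>\<^sub>\<lambda>(F)\<close>, as a pairwise covered set of more than \<open>m\<close> vertices induces an \<open>F\<close>-free hypergraph.\<close>
locale coreless =
  fixes V :: "'a set" and \<E> :: "'a set set" and m r :: nat and \<rho> :: real
  assumes finite_V: "finite V"
    and edges: "e \<in> \<E> \<Longrightarrow> e \<subseteq> V \<and> card e = r"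
    and r_ge: "2 \<le> r" and r_le: "r \<le> m"
    and no_core: "\<lbrakk>U \<subseteq> V; card U = m; nsets U r \<subseteq> \<E>; y \<in> V; y \<notin> U; f \<subseteq> U; insert y f \<in> \<E>\<rbrakk>
      \<Longrightarrow> \<exists>u\<in>U. \<forall>e\<in>\<E>. \<not> (u \<in> e \<and> y \<in> e)"
    and sparse: "\<lbrakk>S \<subseteq> V; m < card S; pairwise_covered \<E> S; \<And>i. 0 \<le> x i; sum x S = 1\<rbrakk>
      \<Longrightarrow> fact r * wt x {e \<in> \<E>. e \<subseteq> S} \<le> \<rho>"
    and \<rho>_less: "\<rho> < turan_density m r"
begin

abbreviation prob :: "('a \<Rightarrow> real) \<Rightarrow> bool" where
  "prob x \<equiv> (\<forall>i. 0 \<le> x i) \<and> sum x V = 1"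

lemma finite_edge: "e \<in> \<E> \<Longrightarrow> finite e"
  using edges finite_V finite_subset by blast

lemma finite_\<E>: "finite \<E>"
  using edges finite_V by (intro finite_subset[of \<E> "Pow V"]) auto

lemma wt_support: "S = {i \<in> V. x i \<noteq> 0} \<Longrightarrow> wt x {e \<in> \<E>. e \<subseteq> S} = wt x \<E>"
  unfolding wt_def using finite_\<E> edges finite_edge
  by (intro sum.mono_neutral_left) (auto intro!: prod_zero)

lemma sum_support: "S = {i \<in> V. x i \<noteq> 0} \<Longrightarrow> sum x S = sum x V"
  using finite_V by (intro sum.mono_neutral_left) auto

lemma sum_transfer:
  fixes x :: "'a \<Rightarrow> real"
  shows "u \<in> V \<Longrightarrow> v \<in> V \<Longrightarrow> u \<noteq> v \<Longrightarrow> sum (x(u := x u + t, v := x v - t)) V = sum x V"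
proof -
  assume uv: "u \<in> V" "v \<in> V" "u \<noteq> v"
  let ?W = "V - {u, v}"
  have V: "V = insert u (insert v ?W)" using uv by auto
  have "sum (x(u := x u + t, v := x v - t)) ?W = sum x ?W" by (rule sum.cong) auto
  then show ?thesis
    by (subst (1 2) V) (use uv finite_V in \<open>simp add: algebra_simps\<close>)
qed

text \<open>A transfer empties \<open>v\<close>, so the support shrinks until it is pairwise
  covered. As an induction rule this serves both the upper bound and the stability statement, which
  is carried backwards from the end of the process.\<close>

lemma symmetrization_induct [consumes 1, case_names covered transfer]:
  assumes "prob x"
    and covered: "\<And>x. prob x \<Longrightarrow> pairwise_covered \<E> {i \<in> V. x i \<noteq> 0} \<Longrightarrow> P x"
    and transfer: "\<And>x u v. \<lbrakk>prob x; u \<in> V; v \<in> V; u \<noteq> v; \<And>e. e \<in> \<E> \<Longrightarrow> \<not> (u \<in> e \<and> v \<in> e);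
        wt x (link \<E> v) \<le> wt x (link \<E> u); P (x(u := x u + x v, v := x v - x v))\<rbrakk> \<Longrightarrow> P x"
  shows "P x"
  using assms(1)
proof (induction "card {i \<in> V. x i \<noteq> 0}" arbitrary: x rule: less_induct)
  case less
  show ?case
  proof (cases "pairwise_covered \<E> {i \<in> V. x i \<noteq> 0}")
    case True then show ?thesis using covered less.prems by blast
  next
    case False
    then obtain a b where ab: "a \<in> V" "b \<in> V" "a \<noteq> b" "x a \<noteq> 0" "x b \<noteq> 0"
      "\<And>e. e \<in> \<E> \<Longrightarrow> \<not> (a \<in> e \<and> b \<in> e)"
      unfolding pairwise_covered_def by auto
    obtain u v where uv: "u \<in> V" "v \<in> V" "u \<noteq> v" "x u \<noteq> 0" "x v \<noteq> 0"
      "\<And>e. e \<in> \<E> \<Longrightarrow> \<not> (u \<in> e \<and> v \<in> e)" "wt x (link \<E> v) \<le> wt x (link \<E> u)"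
    proof (cases "wt x (link \<E> b) \<le> wt x (link \<E> a)")
      case True with ab that[of a b] show ?thesis by blast
    next
      case False with ab that[of b a] show ?thesis by (metis linear)
    qed
    let ?y = "x(u := x u + x v, v := x v - x v)"
    have "{i \<in> V. ?y i \<noteq> 0} \<subseteq> {i \<in> V. x i \<noteq> 0} - {v}" using uv by auto
    also have "\<dots> \<subset> {i \<in> V. x i \<noteq> 0}" using uv by auto
    finally have "card {i \<in> V. ?y i \<noteq> 0} < card {i \<in> V. x i \<noteq> 0}"
      using finite_V by (intro psubset_card_mono) auto
    moreover have "sum ?y V = 1" by (subst sum_transfer) (use uv less.prems in auto)
    then have "prob ?y" using less.prems by simp
    ultimately have "P ?y" using less.hyps by blast
    with transfer uv less.prems show ?thesis by blast
  qed
qed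

lemma wt_transfer:
  assumes "u \<noteq> v" "\<And>e. e \<in> \<E> \<Longrightarrow> \<not> (u \<in> e \<and> v \<in> e)"
    "wt x (link \<E> v) \<le> wt x (link \<E> u)" "0 \<le> t"
  shows "wt x \<E> \<le> wt (x(u := x u + t, v := x v - t)) \<E>"
  using wt_shift[OF finite_\<E> finite_edge assms(1,2), of x t] assms(3,4) by simp

lemma wt_le_turan:
  assumes "prob x" shows "wt x \<E> \<le> turan_density m r / fact r"
  using assms
proof (induction rule: symmetrization_induct)
  case (transfer x u v)
  have "wt x \<E> \<le> wt (x(u := x u + x v, v := x v - x v)) \<E>"
    using transfer by (intro wt_transfer) auto
  from this transfer(7) show ?case by (rule order_trans)
next
  case (covered x)
  let ?S = "{i \<in> V. x i \<noteq> 0}"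
  have S: "sum x ?S = 1" "wt x {e \<in> \<E>. e \<subseteq> ?S} = wt x \<E>" "finite ?S"
    using covered wt_support[OF refl, of x] sum_support[OF refl, of x] finite_V by auto
  show ?case
  proof (cases "m < card ?S")
    case True
    have "fact r * wt x {e \<in> \<E>. e \<subseteq> ?S} \<le> \<rho>"
      using covered True S by (intro sparse) auto
    then have "fact r * wt x \<E> < turan_density m r" using S \<rho>_less by simp
    then show ?thesis by (simp add: field_simps)
  next
    case False
    have "card ?S \<noteq> 0" using S by (metis card_0_eq sum.empty zero_neq_one)
    have "wt x {e \<in> \<E>. e \<subseteq> ?S} \<le> wt x (nsets ?S r)"
      using covered S edges finite_edge
      by (intro wt_mono finite_imp_finite_nsets) (auto simp: nsets_def)
    also have "\<dots> \<le> real (card ?S choose r) * (1 / card ?S) ^ r"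
      using covered S \<open>card ?S \<noteq> 0\<close> by (intro maclaurin) auto
    also have "\<dots> \<le> turan_density m r / fact r"
      using turan_density_mono[of "card ?S" m r] False
      unfolding turan_density_choose by (simp add: divide_right_mono)
    finally show ?thesis using S by simp
  qed
qed

lemma wt_le_turan_scaled:
  assumes "\<And>i. 0 \<le> y i" "0 < sum y V"
  shows "wt y \<E> \<le> turan_density m r / fact r * sum y V ^ r"
proof -
  let ?s = "sum y V"
  have "prob (\<lambda>i. y i / ?s)" using assms by (simp flip: sum_divide_distrib)
  then have "wt (\<lambda>i. y i / ?s) \<E> \<le> turan_density m r / fact r" by (rule wt_le_turan)
  moreover have "wt (\<lambda>i. y i / ?s) \<E> = wt y \<E> / ?s ^ r"
  proof -
    have "wt (\<lambda>i. y i / ?s) \<E> = (\<Sum>e\<in>\<E>. (\<Prod>i\<in>e. y i) / ?s ^ r)"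
      unfolding wt_def using edges by (intro sum.cong) (auto simp: prod_dividef)
    then show ?thesis by (simp add: wt_def sum_divide_distrib)
  qed
  ultimately show ?thesis using assms by (simp add: field_simps)
qed

text \<open>If the vertices of low degree had weight at least \<open>\<epsilon>\<close>, then scaling their weights down by a
  common factor so that exactly \<open>\<epsilon>\<close> is removed would violate the upper bound.\<close>
lemma low_degree_weight:
  assumes "prob x" "0 < \<epsilon>" "\<epsilon> < 1"
    and high: "(turan_density m r - \<epsilon>\<^sup>2) / fact r \<le> wt x \<E>"
    and low: "Z \<subseteq> V" "\<And>v. v \<in> Z \<Longrightarrow> wt x (link \<E> v) \<le> (turan_density m r - 2 * real r ^ 2 * \<epsilon>) / fact (r - 1)"
  shows "sum x Z < \<epsilon>"
proof (rule ccontr)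
  assume "\<not> sum x Z < \<epsilon>"
  let ?\<mu> = "turan_density m r" and ?z = "sum x Z" and ?\<eta> = "2 * real r ^ 2 * \<epsilon>"
  have z: "\<epsilon> \<le> ?z" using \<open>\<not> sum x Z < \<epsilon>\<close> by simp
  define t where "t = \<epsilon> / ?z"
  have t: "0 \<le> t" "t \<le> 1" "t * ?z = \<epsilon>" using z assms by (auto simp: t_def)
  define y where "y = (\<lambda>i. if i \<in> Z then (1 - t) * x i else x i)"
  have y: "0 \<le> y i" "y i \<le> x i" for i
    using t assms(1) by (auto simp: y_def mult_left_le_one_le)
  have finZ: "finite Z" using low finite_V finite_subset by blast
  have xy: "x v - y v = t * x v" if "v \<in> Z" for v using that by (simp add: y_def algebra_simps)
  have "sum x V - sum y V = (\<Sum>v\<in>V. if v \<in> Z then t * x v else 0)"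
    unfolding sum_subtractf[symmetric] by (intro sum.cong) (auto simp: y_def algebra_simps)
  also have "\<dots> = (\<Sum>v\<in>Z. t * x v)"
    using finite_V low(1) by (simp add: sum.inter_restrict[symmetric] Int_absorb1)
  finally have sumy: "sum y V = 1 - \<epsilon>" using t assms(1) by (simp add: sum_distrib_left)
  have "wt x \<E> \<le> wt y \<E> + (\<Sum>v\<in>Z. (x v - y v) * wt x (link \<E> v))"
    using y by (intro wt_decrease[OF finite_\<E> finite_edge finZ]) (auto simp: y_def)
  also have "(\<Sum>v\<in>Z. (x v - y v) * wt x (link \<E> v)) \<le> (\<Sum>v\<in>Z. (t * x v) * ((?\<mu> - ?\<eta>) / fact (r - 1)))"
  proof (rule sum_mono)
    fix v assume v: "v \<in> Z"
    have "0 \<le> t * x v" using t(1) assms(1) by simp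
    then show "(x v - y v) * wt x (link \<E> v) \<le> (t * x v) * ((?\<mu> - ?\<eta>) / fact (r - 1))"
      unfolding xy[OF v] by (rule mult_left_mono[OF low(2)[OF v]])
  qed
  also have "\<dots> = \<epsilon> * ((?\<mu> - ?\<eta>) / fact (r - 1))"
    using t(3) by (simp only: sum_distrib_right[symmetric] sum_distrib_left[symmetric])
  also have "\<dots> = real r * \<epsilon> * (?\<mu> - ?\<eta>) / fact r"
    using r_ge by (simp add: fact_reduce field_simps)
  also have "wt y \<E> \<le> ?\<mu> / fact r * (1 - \<epsilon>) ^ r"
    using wt_le_turan_scaled[of y] y sumy assms by simp
  finally have "(?\<mu> - \<epsilon>\<^sup>2) / fact r \<le> (?\<mu> * (1 - \<epsilon>) ^ r + real r * \<epsilon> * (?\<mu> - ?\<eta>)) / fact r"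
    using high by (simp add: add_divide_distrib)
  then have "?\<mu> - \<epsilon>\<^sup>2 \<le> ?\<mu> * (1 - \<epsilon>) ^ r + real r * \<epsilon> * (?\<mu> - ?\<eta>)"
    by (simp add: divide_le_cancel)
  also have "?\<mu> * (1 - \<epsilon>) ^ r \<le> ?\<mu> * (1 - real r * \<epsilon> + real r ^ 2 * \<epsilon> ^ 2)"
    using power_le_quadratic[of \<epsilon> r] assms turan_density_nonneg by (intro mult_left_mono) auto
  \<comment> \<open>The linear terms cancel. What remains is of order
    \<open>\<epsilon>\<^sup>2\<close>, and the constant \<open>2 * real r ^ 2\<close> in the degree
    threshold makes the negative term \<open>2 * real r ^ 3\<close> outweigh both the quadratic
    error and the deficit of the value.\<close>
  also have "\<dots> + real r * \<epsilon> * (?\<mu> - ?\<eta>) = ?\<mu> + ?\<mu> * (real r ^ 2 * \<epsilon> ^ 2) - 2 * real r ^ 3 * \<epsilon>\<^sup>2"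
    by (simp add: algebra_simps power2_eq_square power3_eq_cube)
  also have "?\<mu> * (real r ^ 2 * \<epsilon> ^ 2) \<le> real r ^ 2 * \<epsilon> ^ 2"
    using turan_density_le_1[of m r] by (intro mult_left_le_one_le) (auto simp: turan_density_nonneg)
  finally have "2 * real r ^ 3 * \<epsilon>\<^sup>2 \<le> (real r ^ 2 + 1) * \<epsilon>\<^sup>2" by (simp add: algebra_simps)
  then have "2 * real r ^ 3 \<le> real r ^ 2 + 1" using assms by simp
  moreover have "2 * real r ^ 2 \<le> real r ^ 3"
    using r_ge by (simp add: power3_eq_cube power2_eq_square)
  moreover have "1 < real r ^ 2" using r_ge by (simp add: one_less_power)
  ultimately show False by linarith
qed

end

subsection \<open>Transversals of a partition\<close>

lemma sum_tuples:
  fixes x :: "'a \<Rightarrow> real"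
  shows "finite J \<Longrightarrow> (\<And>j. j \<in> J \<Longrightarrow> finite (P j)) \<Longrightarrow>
    (\<Sum>t\<in>PiE J P. \<Prod>j\<in>J. x (t j)) = (\<Prod>j\<in>J. sum x (P j))"
  using prod_sum_PiE[of J P "\<lambda>_. x"] by simp

text \<open>Independence of coordinates under a product measure: those outside \<open>R\<close> are
  unrestricted and contribute the full weight of their parts.\<close>

lemma sum_cylinder:
  fixes x :: "'a \<Rightarrow> real"
  assumes "finite J" "\<And>j. j \<in> J \<Longrightarrow> finite (P j)" "R \<subseteq> J" "B \<subseteq> PiE R P"
  shows "(\<Sum>t | t \<in> PiE J P \<and> restrict t R \<in> B. \<Prod>j\<in>J. x (t j))
    = (\<Sum>s\<in>B. \<Prod>j\<in>R. x (s j)) * (\<Prod>j\<in>J - R. sum x (P j))"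
proof -
  let ?S = "{t. t \<in> PiE J P \<and> restrict t R \<in> B}"
  have finR: "finite R" using assms finite_subset by blast
  have fin: "finite (PiE J P)" "finite (PiE R P)"
    using assms finR by (auto intro!: finite_PiE)
  then have fin': "finite ?S" "finite B" using assms(4) finite_subset by auto
  have "(\<Sum>t\<in>?S. \<Prod>j\<in>J. x (t j)) = (\<Sum>s\<in>B. \<Sum>t | t \<in> ?S \<and> restrict t R = s. \<Prod>j\<in>J. x (t j))"
    using fin' by (intro sum.group[symmetric]) auto
  also have "\<dots> = (\<Sum>s\<in>B. (\<Prod>j\<in>R. x (s j)) * (\<Prod>j\<in>J - R. sum x (P j)))"
  proof (intro sum.cong refl)
    fix s assume s: "s \<in> B"
    let ?P = "\<lambda>j. if j \<in> R then {s j} else P j"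
    have sR: "s \<in> PiE R P" using s assms by auto
    have "{t. t \<in> ?S \<and> restrict t R = s} = PiE J ?P"
    proof (intro set_eqI iffI)
      fix t assume "t \<in> {t. t \<in> ?S \<and> restrict t R = s}"
      then show "t \<in> PiE J ?P" by (auto simp: PiE_iff)
    next
      fix t assume t: "t \<in> PiE J ?P"
      have "restrict t R = s"
      proof
        fix j show "restrict t R j = s j"
          using PiE_mem[OF t, of j] PiE_arb[OF sR, of j] assms(3) by auto
      qed
      moreover have "t \<in> PiE J P"
      proof (rule PiE_I)
        fix j assume "j \<in> J" then show "t j \<in> P j"
          using PiE_mem[OF t, of j] PiE_mem[OF sR, of j] by (auto split: if_splits)
      next
        fix j assume "j \<notin> J" then show "t j = undefined" using PiE_arb[OF t] by blast
      qed
      ultimately show "t \<in> {t. t \<in> ?S \<and> restrict t R = s}" using s by auto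
    qed
    then have "(\<Sum>t | t \<in> ?S \<and> restrict t R = s. \<Prod>j\<in>J. x (t j)) = (\<Prod>j\<in>J. sum x (?P j))"
      using assms by (simp add: sum_tuples)
    also have "\<dots> = (\<Prod>j\<in>J - R. sum x (?P j)) * (\<Prod>j\<in>R. sum x (?P j))"
      using assms by (intro prod.subset_diff)
    finally show "(\<Sum>t | t \<in> ?S \<and> restrict t R = s. \<Prod>j\<in>J. x (t j))
        = (\<Prod>j\<in>R. x (s j)) * (\<Prod>j\<in>J - R. sum x (P j))"
      by (simp add: mult.commute)
  qed
  finally show ?thesis by (simp add: sum_distrib_right)
qed

definition transversal_family :: "('i \<Rightarrow> 'a set) \<Rightarrow> 'i set \<Rightarrow> nat \<Rightarrow> 'a set set \<Rightarrow> bool" where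
  "transversal_family P J q L \<longleftrightarrow>
     (\<forall>f\<in>L. f \<subseteq> (\<Union>j\<in>J. P j) \<and> card f = q \<and> finite f \<and> (\<forall>j\<in>J. card (f \<inter> P j) \<le> 1))"

lemma transversal_tuple:
  assumes "finite J" "disjoint_family_on P J" "transversal_family P J q L" "f \<in> L"
  obtains R s where "R \<in> nsets J q" "s \<in> PiE R P" "s ` R = f" "inj_on s R"
proof -
  have f: "f \<subseteq> (\<Union>j\<in>J. P j)" "card f = q" "finite f" "\<And>j. j \<in> J \<Longrightarrow> card (f \<inter> P j) \<le> 1"
    using assms by (auto simp: transversal_family_def)
  define R where "R = {j \<in> J. f \<inter> P j \<noteq> {}}"
  define s where "s = restrict (\<lambda>j. SOME a. a \<in> f \<inter> P j) R"
  have s: "s j \<in> f" "s j \<in> P j" if "j \<in> R" for j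
    using that someI_ex[of "\<lambda>a. a \<in> f \<inter> P j"] by (auto simp: R_def s_def)
  have inj: "inj_on s R"
  proof (rule inj_onI, rule ccontr)
    fix i j assume ij: "i \<in> R" "j \<in> R" "s i = s j" "i \<noteq> j"
    then have "P i \<inter> P j = {}" using assms(2) by (auto simp: disjoint_family_on_def R_def)
    with s(2)[OF ij(1)] s(2)[OF ij(2)] ij(3) show False by auto
  qed
  have "f \<subseteq> s ` R"
  proof
    fix a assume a: "a \<in> f"
    then obtain j where j: "j \<in> J" "a \<in> P j" using f by blast
    then have "j \<in> R" using a by (auto simp: R_def)
    moreover have "a = s j"
      using f(4)[OF j(1)] s[OF \<open>j \<in> R\<close>] a j f(3) card_le_Suc0_iff_eq[of "f \<inter> P j"] by auto
    ultimately show "a \<in> s ` R" by blast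
  qed
  then have img: "s ` R = f" using s by auto
  have "card R = q" using card_image[OF inj] img f by simp
  moreover have "finite R" "R \<subseteq> J" using assms by (auto simp: R_def)
  ultimately have "R \<in> nsets J q" by (auto simp: nsets_def)
  moreover have "s \<in> PiE R P" using s by (auto simp: s_def)
  ultimately show thesis using that img inj by blast
qed

lemma wt_le_tuples:
  fixes x :: "'a \<Rightarrow> real" and P :: "'i \<Rightarrow> 'a set"
  assumes "finite J" "disjoint_family_on P J" "\<And>j. j \<in> J \<Longrightarrow> finite (P j)" "\<And>i. 0 \<le> x i"
    and "finite L" "transversal_family P J q L"
  shows "wt x L \<le> (\<Sum>R\<in>nsets J q. \<Sum>s | s \<in> PiE R P \<and> s ` R \<in> L. \<Prod>j\<in>R. x (s j))"
proof -
  have fin: "finite {s. s \<in> PiE R P \<and> s ` R \<in> L}" if "R \<in> nsets J q" for R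
  proof -
    have "finite R" "\<And>j. j \<in> R \<Longrightarrow> finite (P j)" using that assms(3) by (auto simp: nsets_def)
    then have "finite (PiE R P)" by (rule finite_PiE)
    then show ?thesis by auto
  qed
  have "wt x L \<le> (\<Sum>(R, s)\<in>(SIGMA R:nsets J q. {s. s \<in> PiE R P \<and> s ` R \<in> L}). \<Prod>j\<in>R. x (s j))"
    unfolding wt_def
  proof (rule sum_le_included[where i = "\<lambda>(R, s). s ` R"])
    show "finite (SIGMA R:nsets J q. {s. s \<in> PiE R P \<and> s ` R \<in> L})"
      using assms fin by (intro finite_SigmaI finite_imp_finite_nsets)
    show "\<forall>y\<in>(SIGMA R:nsets J q. {s. s \<in> PiE R P \<and> s ` R \<in> L}). 0 \<le> (case y of (R, s) \<Rightarrow> \<Prod>j\<in>R. x (s j))"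
      using assms(4) by (auto intro!: prod_nonneg)
    show "\<forall>f\<in>L. \<exists>y\<in>(SIGMA R:nsets J q. {s. s \<in> PiE R P \<and> s ` R \<in> L}).
        (case y of (R, s) \<Rightarrow> s ` R) = f \<and> prod x f \<le> (case y of (R, s) \<Rightarrow> \<Prod>j\<in>R. x (s j))"
    proof
      fix f assume f: "f \<in> L"
      then obtain R s where Rs: "R \<in> nsets J q" "s \<in> PiE R P" "s ` R = f" "inj_on s R"
        using transversal_tuple[OF assms(1,2,6)] by blast
      then have "prod x f = (\<Prod>j\<in>R. x (s j))" using prod.reindex[of s R x] by simp
      with Rs f show "\<exists>y\<in>(SIGMA R:nsets J q. {s. s \<in> PiE R P \<and> s ` R \<in> L}).
        (case y of (R, s) \<Rightarrow> s ` R) = f \<and> prod x f \<le> (case y of (R, s) \<Rightarrow> \<Prod>j\<in>R. x (s j))"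
        by (intro bexI[of _ "(R, s)"]) auto
    qed
  qed (use assms in auto)
  then show ?thesis using fin assms(1) by (simp add: sum.Sigma finite_imp_finite_nsets)
qed

lemma tuples_split:
  fixes x :: "'a \<Rightarrow> real"
  assumes "finite R" "\<And>j. j \<in> R \<Longrightarrow> finite (P j)"
  shows "(\<Sum>s | s \<in> PiE R P \<and> s ` R \<in> L. \<Prod>j\<in>R. x (s j)) + (\<Sum>s | s \<in> PiE R P \<and> s ` R \<notin> L. \<Prod>j\<in>R. x (s j))
    = (\<Prod>j\<in>R. sum x (P j))"
proof -
  have fin: "finite (PiE R P)" using assms by (intro finite_PiE)
  have "PiE R P = {s. s \<in> PiE R P \<and> s ` R \<in> L} \<union> {s. s \<in> PiE R P \<and> s ` R \<notin> L}" by auto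
  then have "(\<Sum>s\<in>PiE R P. \<Prod>j\<in>R. x (s j)) = (\<Sum>s | s \<in> PiE R P \<and> s ` R \<in> L. \<Prod>j\<in>R. x (s j))
      + (\<Sum>s | s \<in> PiE R P \<and> s ` R \<notin> L. \<Prod>j\<in>R. x (s j))"
    using fin by (subst sum.union_disjoint[symmetric]) auto
  then show ?thesis using assms by (simp add: sum_tuples)
qed

text \<open>The elementary symmetric polynomial of the part weights is the weight of all transversal
  tuples. Its excess over \<open>wt x L\<close> therefore bounds the missing tuples over all index
  sets together, in particular over a single \<open>R\<close>.\<close>

lemma missing_le:
  fixes x :: "'a \<Rightarrow> real" and P :: "'i \<Rightarrow> 'a set"
  assumes "finite J" "disjoint_family_on P J" "\<And>j. j \<in> J \<Longrightarrow> finite (P j)" "\<And>i. 0 \<le> x i"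
    and "finite L" "transversal_family P J q L" "R \<in> nsets J q"
  shows "(\<Sum>s | s \<in> PiE R P \<and> s ` R \<notin> L. \<Prod>j\<in>R. x (s j)) \<le> wt (\<lambda>j. sum x (P j)) (nsets J q) - wt x L"
proof -
  let ?miss = "\<lambda>R. \<Sum>s | s \<in> PiE R P \<and> s ` R \<notin> L. \<Prod>j\<in>R. x (s j)"
  let ?hit = "\<lambda>R. \<Sum>s | s \<in> PiE R P \<and> s ` R \<in> L. \<Prod>j\<in>R. x (s j)"
  have "?miss R \<le> (\<Sum>R\<in>nsets J q. ?miss R)"
    using assms by (intro member_le_sum) (auto intro!: sum_nonneg prod_nonneg finite_imp_finite_nsets)
  also have "\<dots> = (\<Sum>R\<in>nsets J q. (\<Prod>j\<in>R. sum x (P j)) - ?hit R)"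
  proof (intro sum.cong refl)
    fix R assume "R \<in> nsets J q"
    then have "finite R" "\<And>j. j \<in> R \<Longrightarrow> finite (P j)" using assms by (auto simp: nsets_def)
    from tuples_split[where R = R and P = P and x = x and L = L, OF this] show "?miss R = (\<Prod>j\<in>R. sum x (P j)) - ?hit R" by simp
  qed
  also have "\<dots> \<le> wt (\<lambda>j. sum x (P j)) (nsets J q) - wt x L"
    using wt_le_tuples[OF assms(1-6)] by (simp add: sum_subtractf wt_def)
  finally show ?thesis .
qed

lemma wt_le_parts:
  fixes x :: "'a \<Rightarrow> real" and P :: "'i \<Rightarrow> 'a set"
  assumes "finite J" "disjoint_family_on P J" "\<And>j. j \<in> J \<Longrightarrow> finite (P j)" "\<And>i. 0 \<le> x i"
    and "finite L" "transversal_family P J q L"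
  shows "wt x L \<le> wt (\<lambda>j. sum x (P j)) (nsets J q)"
proof (cases "nsets J q = {}")
  case True
  then have "L = {}" using transversal_tuple[OF assms(1,2,6)] by blast
  then show ?thesis using assms by (simp add: wt_def True)
next
  case False
  then obtain R where "R \<in> nsets J q" by blast
  from missing_le[OF assms this] have "0 \<le> wt (\<lambda>j. sum x (P j)) (nsets J q) - wt x L"
    by (rule order_trans[rotated]) (use assms in \<open>auto intro!: sum_nonneg prod_nonneg\<close>)
  then show ?thesis by simp
qed

text \<open>A union bound over the pairs of a family and an index set.\<close>
lemma select_tuple:
  fixes x :: "'a \<Rightarrow> real" and P :: "'i \<Rightarrow> 'a set"
  assumes J: "finite J" "card J \<le> m" and P: "\<And>j. j \<in> J \<Longrightarrow> finite (P j)"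
    and x: "\<And>i. 0 \<le> x i" "\<And>j. j \<in> J \<Longrightarrow> sum x (P j) \<le> 1"
    and K: "finite K" "card K \<le> k"
    and miss: "\<And>q L R. (q, L) \<in> K \<Longrightarrow> R \<in> nsets J q \<Longrightarrow>
      (\<Sum>s | s \<in> PiE R P \<and> s ` R \<notin> L. \<Prod>j\<in>R. x (s j)) \<le> \<beta>"
    and Q: "Q \<subseteq> PiE J P" "real k * 2 ^ m * \<beta> < (\<Sum>t\<in>Q. \<Prod>j\<in>J. x (t j))" and \<beta>: "0 \<le> \<beta>"
  shows "\<exists>t\<in>Q. \<forall>(q, L)\<in>K. \<forall>R\<in>nsets J q. t ` R \<in> L"
proof -
  \<comment> \<open>A bad event is a family together with an index set \<open>R\<close>. Only the
    coordinates in \<open>R\<close> matter for it, since the other parts contribute factors of at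
    most \<open>1\<close>.\<close>
  define I where "I = (SIGMA c:K. nsets J (fst c))"
  define bad where "bad = (\<lambda>((q :: nat, L), R). {t. t \<in> PiE J P \<and> restrict t R \<in> {s. s \<in> PiE R P \<and> s ` R \<notin> L}})"
  have finQ: "finite (PiE J P)" using J P by (intro finite_PiE)
  have finI: "finite I" unfolding I_def using J K by (intro finite_SigmaI finite_imp_finite_nsets)
  have "I \<subseteq> K \<times> Pow J" by (auto simp: I_def nsets_def)
  then have "card I \<le> card (K \<times> Pow J)" using J K by (intro card_mono) auto
  also have "\<dots> = card K * 2 ^ card J" using J by (simp add: card_cartesian_product card_Pow)
  also have "\<dots> \<le> k * 2 ^ m" using J K by (intro mult_mono) auto
  finally have "real (card I) \<le> real (k * 2 ^ m)" by (simp only: of_nat_le_iff)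
  then have cardI: "real (card I) \<le> real k * 2 ^ m" by simp
  have bad: "(\<Sum>t\<in>bad i. \<Prod>j\<in>J. x (t j)) \<le> \<beta>" "finite (bad i)" if "i \<in> I" for i
  proof -
    obtain q L R where i: "i = ((q, L), R)" by (metis prod.exhaust)
    then have R: "(q, L) \<in> K" "R \<in> nsets J q" "R \<subseteq> J" using that by (auto simp: I_def nsets_def)
    let ?B = "{s. s \<in> PiE R P \<and> s ` R \<notin> L}"
    have "(\<Sum>t\<in>bad i. \<Prod>j\<in>J. x (t j)) = (\<Sum>s\<in>?B. \<Prod>j\<in>R. x (s j)) * (\<Prod>j\<in>J - R. sum x (P j))"
      unfolding bad_def i prod.case by (rule sum_cylinder) (use J P R in auto)
    also have "\<dots> \<le> \<beta> * 1"
      using miss[OF R(1,2)] x \<beta> by (intro mult_mono prod_le_1) (auto intro!: prod_nonneg sum_nonneg)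
    finally show "(\<Sum>t\<in>bad i. \<Prod>j\<in>J. x (t j)) \<le> \<beta>" by simp
    show "finite (bad i)" using finQ by (auto simp: bad_def i)
  qed
  have "\<not> Q \<subseteq> (\<Union>i\<in>I. bad i)"
  proof
    assume sub: "Q \<subseteq> (\<Union>i\<in>I. bad i)"
    have "(\<Sum>t\<in>Q. \<Prod>j\<in>J. x (t j)) \<le> (\<Sum>(i, t)\<in>(SIGMA i:I. bad i). \<Prod>j\<in>J. x (t j))"
    proof (rule sum_le_included[where i = snd])
      show "finite Q" using Q(1) finQ by (rule finite_subset)
      show "finite (SIGMA i:I. bad i)" using finI bad(2) by (rule finite_SigmaI)
      show "\<forall>y\<in>(SIGMA i:I. bad i). 0 \<le> (case y of (i, t) \<Rightarrow> \<Prod>j\<in>J. x (t j))"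
        using x(1) by (simp add: split_beta prod_nonneg)
      show "\<forall>t\<in>Q. \<exists>y\<in>(SIGMA i:I. bad i). snd y = t \<and> (\<Prod>j\<in>J. x (t j)) \<le> (case y of (i, t) \<Rightarrow> \<Prod>j\<in>J. x (t j))"
        using sub by fastforce
    qed
    also have "\<dots> = (\<Sum>i\<in>I. \<Sum>t\<in>bad i. \<Prod>j\<in>J. x (t j))"
      using finI bad(2) by (simp add: sum.Sigma)
    also have "\<dots> \<le> (\<Sum>i\<in>I. \<beta>)" using bad(1) by (rule sum_mono)
    also have "\<dots> \<le> real k * 2 ^ m * \<beta>" using cardI \<beta> by (simp add: mult_right_mono)
    finally show False using Q(2) by simp
  qed
  then obtain t where t: "t \<in> Q" "\<And>i. i \<in> I \<Longrightarrow> t \<notin> bad i" by blast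
  have in_L: "t ` R \<in> L" if R: "(q, L) \<in> K" "R \<in> nsets J q" for q L R
  proof -
    have "((q, L), R) \<in> I" using R by (auto simp: I_def)
    then have "t \<notin> bad ((q, L), R)" by (rule t(2))
    moreover have "t \<in> PiE J P" using t Q by auto
    moreover have "restrict t R \<in> PiE R P"
      using \<open>t \<in> PiE J P\<close> R(2) by (auto simp: nsets_def PiE_iff)
    ultimately show "t ` R \<in> L" by (auto simp: bad_def)
  qed
  with t(1) show ?thesis by blast
qed

lemma nsets_insert_tuple:
  assumes "inj_on t J" "\<And>R. R \<in> nsets J (Suc q) \<Longrightarrow> t ` R \<in> \<E>"
    and "\<And>R. R \<in> nsets J q \<Longrightarrow> insert u (t ` R) \<in> \<E>"
  shows "nsets (insert u (t ` J)) (Suc q) \<subseteq> \<E>"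
proof
  fix e assume "e \<in> nsets (insert u (t ` J)) (Suc q)"
  then have e: "e \<subseteq> insert u (t ` J)" "finite e" "card e = Suc q" by (auto simp: nsets_def)
  define R where "R = {j \<in> J. t j \<in> e - {u}}"
  have img: "t ` R = e - {u}" using e by (auto simp: R_def)
  have inj: "inj_on t R" using assms(1) by (rule inj_on_subset) (auto simp: R_def)
  have finR: "finite R" using img inj e by (metis finite_Diff finite_imageD)
  have cardR: "card R = card (e - {u})" using img inj by (metis card_image)
  show "e \<in> \<E>"
  proof (cases "u \<in> e")
    case True
    then have "R \<in> nsets J q" using finR cardR e by (auto simp: nsets_def R_def)
    from assms(3)[OF this] show ?thesis using img True by (simp add: insert_absorb)
  next
    case False
    then have "R \<in> nsets J (Suc q)" using finR cardR e by (auto simp: nsets_def R_def)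
    from assms(2)[OF this] show ?thesis using img False by simp
  qed
qed

subsection \<open>Extending a partition by a vertex of high degree\<close>

context coreless
begin

text \<open>Lower bound for the weight of every part, see \<open>w_ge\<close>: half of the gap
  between \<open>m\<close> and \<open>m - 1\<close> parts is kept, the other half absorbs
  errors.\<close>

definition c\<^sub>0 :: real where
  "c\<^sub>0 = (turan_density m r - turan_density (m - 1) r) / (2 * fact r)"

text \<open>Threshold between heavy and light. The first term comes from averaging a link over at
  most \<open>2 ^ m\<close> index sets in \<open>heavy_index_set\<close>; the second makes
  \<open>3 * \<kappa>\<close> smaller than \<open>c\<^sub>0 ^ m\<close> in
  \<open>light_index_unique\<close>.\<close>

definition \<kappa> :: real where
  "\<kappa> = min (turan_density m r / (2 * fact (r - 1) * 2 ^ m)) (c\<^sub>0 ^ m / 4)"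

text \<open>Largest admissible error. The first term serves \<open>w_ge\<close>; the second lets a
  set of tuples of weight \<open>\<kappa> ^ (m + 1)\<close> survive a union bound over three
  families and \<open>2 ^ m\<close> index sets, where \<open>7 / 2\<close> instead of
  \<open>3\<close> gives strictness.\<close>

definition \<sigma>\<^sub>0 :: real where
  "\<sigma>\<^sub>0 = min ((turan_density m r - turan_density (m - 1) r) / 4) (c\<^sub>0 * \<kappa> ^ (m + 1) / (7 * 2 ^ m))"

lemma gap: "0 < turan_density m r - turan_density (m - 1) r"
  using turan_density_strict_mono[of "m - 1" m r] r_le r_ge by simp

lemma gap_le: "turan_density m r - turan_density (m - 1) r \<le> turan_density m r"
  using turan_density_nonneg[of "m - 1" r] by simp

lemma c\<^sub>0: "0 < c\<^sub>0" "c\<^sub>0 \<le> 1"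
proof -
  show "0 < c\<^sub>0" using gap by (simp add: c\<^sub>0_def)
  have "turan_density m r - turan_density (m - 1) r \<le> 2 * fact r"
    using gap_le turan_density_le_1[of m r] fact_ge_1[of r, where 'a = real] by linarith
  then show "c\<^sub>0 \<le> 1" by (simp add: c\<^sub>0_def)
qed

lemma \<kappa>: "0 < \<kappa>" "\<kappa> \<le> 1" "\<kappa> \<le> c\<^sub>0 ^ m / 4" "\<kappa> \<le> turan_density m r / (2 * fact (r - 1) * 2 ^ m)"
proof -
  have "c\<^sub>0 ^ m \<le> 1" using c\<^sub>0 by (simp add: power_le_one)
  then show "0 < \<kappa>" "\<kappa> \<le> 1" "\<kappa> \<le> c\<^sub>0 ^ m / 4" "\<kappa> \<le> turan_density m r / (2 * fact (r - 1) * 2 ^ m)"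
    using c\<^sub>0 turan_density_pos[OF r_le] by (auto simp: \<kappa>_def min_le_iff_disj)
qed

lemma \<sigma>\<^sub>0_pos: "0 < \<sigma>\<^sub>0"
  using gap c\<^sub>0 \<kappa> by (simp add: \<sigma>\<^sub>0_def)

definition partite_on :: "'a set \<Rightarrow> bool" where
  "partite_on T \<longleftrightarrow> (\<exists>P :: nat \<Rightarrow> 'a set. disjoint_family_on P {..<m} \<and> (\<Union>i<m. P i) = T \<and>
     (\<forall>e\<in>\<E>. e \<subseteq> T \<longrightarrow> (\<forall>i<m. card (e \<inter> P i) \<le> 1)))"

lemma partite_on_subset:
  assumes "partite_on T" "S \<subseteq> T" shows "partite_on S"
proof -
  obtain P :: "nat \<Rightarrow> 'a set" where P: "disjoint_family_on P {..<m}" "(\<Union>i<m. P i) = T"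
    "\<forall>e\<in>\<E>. e \<subseteq> T \<longrightarrow> (\<forall>i<m. card (e \<inter> P i) \<le> 1)"
    using assms unfolding partite_on_def by blast
  show ?thesis unfolding partite_on_def
  proof (intro exI[of _ "\<lambda>i. P i \<inter> S"] conjI ballI impI allI)
    show "disjoint_family_on (\<lambda>i. P i \<inter> S) {..<m}" using P(1) by (auto simp: disjoint_family_on_def)
    show "(\<Union>i<m. P i \<inter> S) = S" using P(2) assms by auto
    fix e i assume e: "e \<in> \<E>" "e \<subseteq> S" "i < m"
    then have "e \<inter> (P i \<inter> S) = e \<inter> P i" by auto
    then show "card (e \<inter> (P i \<inter> S)) \<le> 1" using P(3) e assms by auto
  qed
qed

end

text \<open>The situation before one more vertex is added. A single \<sigma> bounds both the weight
  outside \<open>T\<close> and the degree deficit; degrees are counted inside \<open>T\<close>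
  because only edges inside \<open>T\<close> are known to be transversal.\<close>

locale partite_subset = coreless +
  fixes x :: "'a \<Rightarrow> real" and T :: "'a set" and P :: "nat \<Rightarrow> 'a set" and \<sigma> :: real
  assumes prob: "\<And>i. 0 \<le> x i" "sum x V = 1"
    and T: "T \<subseteq> V" and disj: "disjoint_family_on P {..<m}" and P_Un: "(\<Union>i<m. P i) = T"
    and P_edges: "\<And>e i. e \<in> \<E> \<Longrightarrow> e \<subseteq> T \<Longrightarrow> i < m \<Longrightarrow> card (e \<inter> P i) \<le> 1"
    and \<sigma>: "0 \<le> \<sigma>" "\<sigma> \<le> \<sigma>\<^sub>0" and sum_T: "1 - \<sigma> \<le> sum x T"
    and deg: "\<And>u. u \<in> T \<Longrightarrow> (turan_density m r - \<sigma>) / fact (r - 1) \<le> wt x {f \<in> link \<E> u. f \<subseteq> T}"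
begin

abbreviation "\<mu> \<equiv> turan_density m r"
definition "low = (\<mu> - \<sigma>) / fact (r - 1)"
definition "w i = sum x (P i)"
text \<open>A total defect of \<open>2 * \<sigma>\<close> averaged over the parts, charged to a
  single part of weight at least \<open>c\<^sub>0\<close>.\<close>

definition "\<beta> = 2 * \<sigma> / c\<^sub>0"
definition "L u = {f \<in> link \<E> u. f \<subseteq> T}"
definition "E\<^sub>T = {e \<in> \<E>. e \<subseteq> T}"

lemma \<sigma>_le: "4 * \<sigma> \<le> \<mu> - turan_density (m - 1) r" "2 * \<sigma> \<le> \<mu>"
  using \<sigma> gap_le gap by (auto simp: \<sigma>\<^sub>0_def)

lemma \<beta>: "0 \<le> \<beta>" "3 * 2 ^ m * \<beta> < \<kappa> ^ (m + 1)" "\<beta> \<le> \<kappa>" "2 * \<sigma> \<le> \<beta>"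
proof -
  show "0 \<le> \<beta>" using \<sigma> c\<^sub>0 by (simp add: \<beta>_def)
  have "\<sigma> \<le> c\<^sub>0 * \<kappa> ^ (m + 1) / (7 * 2 ^ m)" using \<sigma> by (simp add: \<sigma>\<^sub>0_def)
  then have "7 * 2 ^ m * \<sigma> / c\<^sub>0 \<le> \<kappa> ^ (m + 1)" using c\<^sub>0 by (simp add: field_simps)
  then have "7 / 2 * 2 ^ m * \<beta> \<le> \<kappa> ^ (m + 1)" by (simp add: \<beta>_def mult_ac)
  moreover have "0 < \<kappa> ^ (m + 1)" using \<kappa> by simp
  ultimately show *: "3 * 2 ^ m * \<beta> < \<kappa> ^ (m + 1)" using \<open>0 \<le> \<beta>\<close> by linarith
  have "1 * \<beta> \<le> 3 * 2 ^ m * \<beta>" using \<open>0 \<le> \<beta>\<close> one_le_power[of "2::real" m]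
    by (intro mult_right_mono) linarith+
  also have "\<dots> \<le> \<kappa> ^ (m + 1)" using * by simp
  also have "\<dots> \<le> \<kappa> ^ 1" using \<kappa> by (intro power_decreasing) auto
  finally show "\<beta> \<le> \<kappa>" by simp
  show "2 * \<sigma> \<le> \<beta>" using \<sigma> c\<^sub>0 by (auto simp: \<beta>_def field_simps intro: mult_left_le)
qed

lemma low: "0 \<le> low" "low \<le> 1" "\<mu> / (2 * fact (r - 1)) \<le> low"
proof -
  show "0 \<le> low" using \<sigma>_le \<sigma> by (simp add: low_def)
  have "\<mu> - \<sigma> \<le> fact (r - 1)"
    using \<sigma> turan_density_le_1[of m r] fact_ge_1[of "r - 1", where 'a = real] by linarith
  then show "low \<le> 1" by (simp add: low_def)
  show "\<mu> / (2 * fact (r - 1)) \<le> low" using \<sigma>_le by (simp add: low_def field_simps)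
qed

lemma finite_T: "finite T"
  using T finite_V finite_subset by blast

lemma P_subset: "i < m \<Longrightarrow> P i \<subseteq> T"
  using P_Un by auto

lemma finite_P: "i < m \<Longrightarrow> finite (P i)"
  using P_subset finite_T finite_subset by blast

lemma w_nonneg: "0 \<le> w i"
  using prob by (simp add: w_def sum_nonneg)

lemma sum_T_le: "sum x T \<le> 1"
  using sum_mono2[of V T x] prob T finite_V by simp

lemma w_le_1: "i < m \<Longrightarrow> w i \<le> 1"
  using sum_mono2[of T "P i" x] P_subset finite_T prob sum_T_le unfolding w_def by force

lemma sum_w: "sum w {..<m} = sum x T"
proof -
  have "sum x (\<Union>i<m. P i) = (\<Sum>i<m. sum x (P i))"
    using disj finite_P by (intro sum.UNION_disjoint) (auto simp: disjoint_family_on_def)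
  then show ?thesis by (simp add: P_Un w_def)
qed

lemma finite_L: "finite (L u)" and finite_E\<^sub>T: "finite E\<^sub>T"
  using finite_link[OF finite_\<E>] finite_\<E> by (auto simp: L_def E\<^sub>T_def)

lemma L_mem: "f \<in> L u \<Longrightarrow> insert u f \<in> \<E> \<and> u \<notin> f \<and> f \<subseteq> T \<and> finite f \<and> card f = r - 1"
proof -
  assume "f \<in> L u"
  then have f: "insert u f \<in> \<E>" "u \<notin> f" "f \<subseteq> T" by (auto simp: L_def link_def)
  moreover have "finite f" "card (insert u f) = r" using edges[OF f(1)] finite_edge[OF f(1)] by auto
  ultimately show ?thesis by auto
qed

text \<open>Summing the degree condition by \<open>handshake\<close> shows that the edges inside
  \<open>T\<close> alone are nearly extremal.\<close>

lemma wt_E\<^sub>T: "(\<mu> - 2 * \<sigma>) / fact r \<le> wt x E\<^sub>T"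
proof -
  have "(1 - \<sigma>) * low \<le> sum x T * low" using low sum_T by (intro mult_right_mono)
  also have "\<dots> = (\<Sum>u\<in>T. x u * low)" by (simp add: sum_distrib_right)
  also have "\<dots> \<le> (\<Sum>u\<in>T. x u * wt x (link E\<^sub>T u))"
  proof (intro sum_mono mult_left_mono prob)
    fix u assume "u \<in> T"
    moreover from this have "link E\<^sub>T u = {f \<in> link \<E> u. f \<subseteq> T}" by (auto simp: link_def E\<^sub>T_def)
    ultimately show "low \<le> wt x (link E\<^sub>T u)" using deg by (simp add: low_def)
  qed
  also have "\<dots> = real r * wt x E\<^sub>T"
    using edges by (intro handshake finite_T) (auto simp: E\<^sub>T_def)
  finally have *: "(1 - \<sigma>) * low \<le> real r * wt x E\<^sub>T" .
  have "\<mu> - 2 * \<sigma> \<le> (1 - \<sigma>) * (\<mu> - \<sigma>)"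
  proof -
    have "\<sigma> * \<mu> \<le> \<sigma> * 1" using \<sigma> turan_density_le_1 by (intro mult_left_mono)
    moreover have "(1 - \<sigma>) * (\<mu> - \<sigma>) = \<mu> - \<sigma> - \<sigma> * \<mu> + \<sigma> * \<sigma>" by (simp add: algebra_simps)
    ultimately show ?thesis using zero_le_square[of \<sigma>] by linarith
  qed
  then have "(\<mu> - 2 * \<sigma>) / fact (r - 1) \<le> (1 - \<sigma>) * low" by (simp add: low_def divide_right_mono)
  with * have "(\<mu> - 2 * \<sigma>) / fact (r - 1) \<le> real r * wt x E\<^sub>T" by simp
  then show ?thesis using r_ge by (simp add: fact_reduce field_simps)
qed

lemma transversal_E\<^sub>T: "transversal_family P {..<m} r E\<^sub>T"
  using edges finite_edge P_edges P_Un by (auto simp: transversal_family_def E\<^sub>T_def)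

lemma transversal_L:
  assumes "i < m" "u \<in> P i"
  shows "transversal_family P ({..<m} - {i}) (r - 1) (L u)"
  unfolding transversal_family_def
proof (intro ballI conjI)
  fix f assume f: "f \<in> L u"
  note f' = L_mem[OF f]
  have uT: "u \<in> T" using assms P_subset by auto
  have card: "card (insert u f \<inter> P j) \<le> 1" if "j < m" for j using P_edges f' uT that by auto
  show "f \<subseteq> (\<Union>j\<in>{..<m} - {i}. P j)"
  proof
    fix a assume a: "a \<in> f"
    then obtain j where j: "j < m" "a \<in> P j" using f' P_Un by blast
    have "j \<noteq> i"
    proof
      assume "j = i"
      then have "{u, a} \<subseteq> insert u f \<inter> P i" using a j assms by auto
      then have "card {u, a} \<le> card (insert u f \<inter> P i)" using f' by (intro card_mono) auto
      with card[OF assms(1)] have "card {u, a} \<le> 1" by simp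
      moreover have "u \<noteq> a" using a f' by auto
      ultimately show False by simp
    qed
    then show "a \<in> (\<Union>j\<in>{..<m} - {i}. P j)" using j by auto
  qed
  show "card f = r - 1" "finite f" using f' by auto
  fix j assume "j \<in> {..<m} - {i}"
  then have "card (f \<inter> P j) \<le> card (insert u f \<inter> P j)" using f' by (intro card_mono) auto
  then show "card (f \<inter> P j) \<le> 1" using card[of j] \<open>j \<in> {..<m} - {i}\<close> by auto
qed

lemma esym_split:
  "i < m \<Longrightarrow> wt w (nsets {..<m} r) = w i * wt w (nsets ({..<m} - {i}) (r - 1)) + wt w (nsets ({..<m} - {i}) r)"
  using wt_nsets_insert[of i "{..<m} - {i}" w "r - 1"] r_ge by (simp add: insert_absorb)

lemma esym_le: "wt w (nsets {..<m} r) \<le> \<mu> / fact r"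
proof -
  have "wt w (nsets {..<m} r) \<le> real (card {..<m} choose r) * (sum w {..<m} / real m) ^ r"
    using w_nonneg r_le r_ge by (intro maclaurin) auto
  also have "\<dots> \<le> real (m choose r) * (1 / real m) ^ r"
    using sum_w sum_T_le sum_nonneg[of T x] prob(1) by (auto intro!: mult_left_mono power_mono divide_right_mono sum_nonneg)
  finally show ?thesis by (simp add: turan_density_choose)
qed

lemma esym_remove_le:
  assumes "i < m"
  shows "wt w (nsets ({..<m} - {i}) r) \<le> turan_density (m - 1) r / fact r"
proof -
  let ?J = "{..<m} - {i}"
  have c: "card ?J = m - 1" using assms by simp
  have s: "sum w ?J \<le> 1"
    using sum_mono2[of "{..<m}" ?J w] w_nonneg sum_w sum_T_le by auto
  have "wt w (nsets ?J r) \<le> real (card ?J choose r) * (sum w ?J / real (m - 1)) ^ r"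
    using w_nonneg r_le r_ge c by (intro maclaurin) auto
  also have "\<dots> \<le> real (m - 1 choose r) * (1 / real (m - 1)) ^ r"
    unfolding c using s w_nonneg sum_nonneg[of ?J w] by (auto intro!: mult_left_mono power_mono divide_right_mono sum_nonneg)
  finally show ?thesis by (simp add: turan_density_choose)
qed

lemma sum_w_remove_le: "sum w ({..<m} - A) \<le> 1"
  using sum_mono2[of "{..<m}" "{..<m} - A" w] w_nonneg sum_w sum_T_le by auto

text \<open>Transversal edges avoiding part \<open>i\<close> live on \<open>m - 1\<close> parts and
  reach only \<open>turan_density (m - 1) r\<close>; edges meeting part \<open>i\<close> have to
  make up the difference, and they weigh at most \<open>w i\<close>.\<close>

lemma w_ge: assumes "i < m" shows "c\<^sub>0 \<le> w i"
proof -
  have "(\<mu> - 2 * \<sigma>) / fact r \<le> wt w (nsets {..<m} r)"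
    using wt_E\<^sub>T wt_le_parts[where x = x, OF _ disj _ prob(1) finite_E\<^sub>T transversal_E\<^sub>T] finite_P
    unfolding w_def by force
  also have "\<dots> = w i * wt w (nsets ({..<m} - {i}) (r - 1)) + wt w (nsets ({..<m} - {i}) r)"
    by (rule esym_split[OF assms])
  also have "\<dots> \<le> w i * 1 + turan_density (m - 1) r / fact r"
    using w_nonneg sum_w_remove_le esym_remove_le[OF assms]
    by (intro add_mono mult_left_mono wt_nsets_le_1) auto
  finally have "(\<mu> - 2 * \<sigma> - turan_density (m - 1) r) / fact r \<le> w i" by (simp add: diff_divide_distrib)
  moreover have "c\<^sub>0 \<le> (\<mu> - 2 * \<sigma> - turan_density (m - 1) r) / fact r"
  proof -
    have "c\<^sub>0 = ((\<mu> - turan_density (m - 1) r) / 2) / fact r" by (simp add: c\<^sub>0_def)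
    also have "\<dots> \<le> (\<mu> - 2 * \<sigma> - turan_density (m - 1) r) / fact r"
      using \<sigma>_le by (intro divide_right_mono) auto
    finally show ?thesis .
  qed
  ultimately show ?thesis by simp
qed

text \<open>A part of positive weight contains a vertex, and the link of that vertex inside
  \<open>T\<close> is transversal to the other parts.\<close>

lemma low_le_esym:
  assumes "i < m" shows "low \<le> wt w (nsets ({..<m} - {i}) (r - 1))"
proof -
  have "P i \<noteq> {}" using w_ge[OF assms] c\<^sub>0 by (auto simp: w_def)
  then obtain u where u: "u \<in> P i" by blast
  then have "low \<le> wt x (L u)" using deg[of u] P_subset[OF assms] by (auto simp: low_def L_def)
  also have "\<dots> \<le> wt w (nsets ({..<m} - {i}) (r - 1))"
    using wt_le_parts[where x = x, OF _ _ _ prob(1) finite_L transversal_L[OF assms u]] finite_P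
      disjoint_family_on_mono[OF _ disj, of "{..<m} - {i}"]
    unfolding w_def by force
  finally show ?thesis .
qed

text \<open>The weighted average of these symmetric polynomials over the parts is at most \<open>\<mu>\<close>, up to a
  factorial, and none is much smaller than that, so none is much larger.\<close>
lemma esym_le_low:
  assumes "i < m" shows "wt w (nsets ({..<m} - {i}) (r - 1)) \<le> low + \<beta>"
proof -
  let ?E = "\<lambda>i. wt w (nsets ({..<m} - {i}) (r - 1))"
  have "w i * (?E i - low) \<le> (\<Sum>j<m. w j * (?E j - low))"
    using assms low_le_esym w_nonneg by (intro member_le_sum) auto
  also have "\<dots> = (\<Sum>j<m. w j * ?E j) - low * sum x T"
    by (simp add: sum_w[symmetric] algebra_simps sum_subtractf sum_distrib_left)
  also have "(\<Sum>j<m. w j * ?E j) = (\<Sum>j<m. w j * wt w (link (nsets {..<m} r) j))"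
  proof (intro sum.cong refl)
    fix j assume "j \<in> {..<m}"
    then show "w j * ?E j = w j * wt w (link (nsets {..<m} r) j)"
      using nsets_insert(1)[of j "{..<m} - {j}" "r - 1"] r_ge by (simp add: insert_absorb)
  qed
  also have "\<dots> = real r * wt w (nsets {..<m} r)"
    by (rule handshake) (auto simp: nsets_def)
  also have "\<dots> \<le> real r * (\<mu> / fact r)" using esym_le by (intro mult_left_mono) auto
  also have "\<dots> = \<mu> / fact (r - 1)" using r_ge by (simp add: fact_reduce)
  finally have "w i * (?E i - low) \<le> \<mu> / fact (r - 1) - low * sum x T" by simp
  also have "\<dots> \<le> \<mu> / fact (r - 1) - low * (1 - \<sigma>)"
    using mult_left_mono[OF sum_T low(1)] by simp
  also have "\<dots> = \<sigma> / fact (r - 1) + low * \<sigma>" by (simp add: low_def algebra_simps diff_divide_distrib)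
  also have "\<dots> \<le> \<sigma> + 1 * \<sigma>"
    using \<sigma> low mult_left_mono[OF fact_ge_1[of "r - 1"], of \<sigma>]
    by (intro add_mono mult_right_mono) (auto simp: divide_le_eq)
  finally have "w i * (?E i - low) \<le> 2 * \<sigma>" by simp
  moreover have "c\<^sub>0 * (?E i - low) \<le> w i * (?E i - low)"
    using w_ge[OF assms] low_le_esym[OF assms] by (intro mult_right_mono) auto
  ultimately have "c\<^sub>0 * (?E i - low) \<le> 2 * \<sigma>" by simp
  then have "?E i - low \<le> \<beta>" using c\<^sub>0 by (simp add: \<beta>_def field_simps)
  then show ?thesis by simp
qed

lemma missing_E\<^sub>T:
  assumes "R \<in> nsets {..<m} r"
  shows "(\<Sum>s | s \<in> PiE R P \<and> s ` R \<notin> E\<^sub>T. \<Prod>j\<in>R. x (s j)) \<le> \<beta>"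
proof -
  have "(\<Sum>s | s \<in> PiE R P \<and> s ` R \<notin> E\<^sub>T. \<Prod>j\<in>R. x (s j)) \<le> wt w (nsets {..<m} r) - wt x E\<^sub>T"
    using missing_le[where x = x, OF _ disj _ prob(1) finite_E\<^sub>T transversal_E\<^sub>T assms] finite_P
    unfolding w_def by force
  also have "\<dots> \<le> \<mu> / fact r - (\<mu> - 2 * \<sigma>) / fact r" using esym_le wt_E\<^sub>T by simp
  also have "\<dots> = 2 * \<sigma> / fact r" by (simp add: diff_divide_distrib)
  also have "\<dots> \<le> 2 * \<sigma>" using \<sigma> mult_left_mono[OF fact_ge_1[of r], of \<sigma>]
    by (simp add: divide_le_eq)
  finally show ?thesis using \<beta> by simp
qed

lemma missing_L:
  assumes "i < m" "u \<in> P i" "R \<in> nsets ({..<m} - {i}) (r - 1)"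
  shows "(\<Sum>s | s \<in> PiE R P \<and> s ` R \<notin> L u. \<Prod>j\<in>R. x (s j)) \<le> \<beta>"
proof -
  have "(\<Sum>s | s \<in> PiE R P \<and> s ` R \<notin> L u. \<Prod>j\<in>R. x (s j))
      \<le> wt w (nsets ({..<m} - {i}) (r - 1)) - wt x (L u)"
    using missing_le[where x = x, OF _ _ _ prob(1) finite_L transversal_L[OF assms(1,2)] assms(3)] finite_P
      disjoint_family_on_mono[OF _ disj, of "{..<m} - {i}"]
    unfolding w_def by force
  moreover have "low \<le> wt x (L u)" using deg[of u] P_subset[OF assms(1)] assms(2) by (auto simp: low_def L_def)
  ultimately show ?thesis using esym_le_low[OF assms(1)] by simp
qed

text \<open>A union bound over \<open>E\<^sub>T\<close> and the links of at most two prescribed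
  vertices of part \<open>k\<close>. The set \<open>Q\<close> carries whatever else the tuple must
  satisfy; the prescribed vertices themselves need no weight.\<close>

lemma complete_tuple:
  assumes k: "k < m" and us: "\<And>u. u \<in> us \<Longrightarrow> u \<in> P k" "finite us" "card us \<le> 2"
    and Q: "Q \<subseteq> PiE ({..<m} - {k}) P" "\<kappa> ^ (m + 1) \<le> (\<Sum>t\<in>Q. \<Prod>j\<in>{..<m} - {k}. x (t j))"
  shows "\<exists>t\<in>Q. inj_on t ({..<m} - {k}) \<and> (\<forall>u\<in>us. u \<notin> t ` ({..<m} - {k}) \<and>
    (\<forall>R\<in>nsets ({..<m} - {k}) (r - 1). insert u (t ` R) \<in> \<E>) \<and>
    nsets (insert u (t ` ({..<m} - {k}))) r \<subseteq> \<E> \<and>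
    card (insert u (t ` ({..<m} - {k}))) = m \<and> insert u (t ` ({..<m} - {k})) \<subseteq> T)"
proof -
  let ?J = "{..<m} - {k}"
  let ?K = "insert (r, E\<^sub>T) ((\<lambda>u. (r - 1, L u)) ` us)"
  have cardK: "card ?K \<le> 3"
    using us card_image_le[of us "\<lambda>u. (r - 1, L u)"] card_insert_le_m1[of 3 "(\<lambda>u. (r - 1, L u)) ` us"]
    by simp
  have J: "finite ?J" "card ?J \<le> m" using k by auto
  have miss: "(\<Sum>s | s \<in> PiE R P \<and> s ` R \<notin> F. \<Prod>j\<in>R. x (s j)) \<le> \<beta>" if "(q, F) \<in> ?K" "R \<in> nsets ?J q" for q F R
    using that missing_E\<^sub>T[of R] missing_L[OF k us(1)] nsets_mono[of ?J "{..<m}"] by auto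
  have "real 3 * 2 ^ m * \<beta> < (\<Sum>t\<in>Q. \<Prod>j\<in>?J. x (t j))" using \<beta> Q(2) by simp
  note large = this
  have finP: "finite (P j)" "sum x (P j) \<le> 1" if "j \<in> ?J" for j
    using finite_P w_le_1 that unfolding w_def by auto
  have finK: "finite ?K" using us(2) by simp
  have "\<exists>t\<in>Q. \<forall>(q, F)\<in>?K. \<forall>R\<in>nsets ?J q. t ` R \<in> F"
    by (rule select_tuple[where x = x and P = P, OF J _ prob(1) _ finK cardK _ Q(1) large \<beta>(1)])
      (erule finP | erule (1) miss)+
  then obtain t where t: "t \<in> Q" "\<And>q F R. (q, F) \<in> ?K \<Longrightarrow> R \<in> nsets ?J q \<Longrightarrow> t ` R \<in> F"
    by blast
  have tP: "t j \<in> P j" if "j \<in> ?J" for j using t(1) Q(1) that by (auto dest: PiE_mem)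
  have inj: "inj_on t ?J"
  proof (rule inj_onI, rule ccontr)
    fix i j assume ij: "i \<in> ?J" "j \<in> ?J" "t i = t j" "i \<noteq> j"
    then have "P i \<inter> P j = {}" using disj by (auto simp: disjoint_family_on_def)
    with tP[OF ij(1)] tP[OF ij(2)] ij(3) show False by auto
  qed
  have link: "insert u (t ` R) \<in> \<E>" if "u \<in> us" "R \<in> nsets ?J (r - 1)" for u R
    using t(2)[of "r - 1" "L u" R] that by (auto simp: L_def link_def)
  have notin: "u \<notin> t ` ?J" if "u \<in> us" for u
  proof
    assume "u \<in> t ` ?J"
    then obtain j where j: "j \<in> ?J" "u = t j" by auto
    then have "P j \<inter> P k = {}" using disj k by (auto simp: disjoint_family_on_def)
    with tP[OF j(1)] us(1)[OF that] j show False by auto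
  qed
  have "nsets (insert u (t ` ?J)) r \<subseteq> \<E>" if "u \<in> us" for u
    using nsets_insert_tuple[OF inj, of "r - 1" \<E> u] link[OF that] t(2)[of r E\<^sub>T] r_ge
    by (auto simp: E\<^sub>T_def)
  moreover have "card (insert u (t ` ?J)) = m" if "u \<in> us" for u
    using notin[OF that] card_image[OF inj] k by simp
  moreover have "insert u (t ` ?J) \<subseteq> T" if "u \<in> us" for u
    using us(1)[OF that] P_subset k tP by blast
  ultimately show ?thesis using t(1) inj link notin by blast
qed

text \<open>Two vertices of the same part that are covered by an edge would be the non-adjacent pair in
  a copy of the complete \<open>r\<close>-graph on \<open>m + 1\<close> vertices minus the edges through that pair.\<close>
lemma edge_transversal:
  assumes e: "e \<in> \<E>" "i < m"
  shows "card (e \<inter> P i) \<le> 1"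
proof (rule ccontr)
  assume "\<not> ?thesis"
  then obtain u y where u: "u \<in> e \<inter> P i" "y \<in> e \<inter> P i" "u \<noteq> y"
    using card_le_Suc0_iff_eq[of "e \<inter> P i"] finite_edge[OF e(1)] by auto
  let ?J = "{..<m} - {i}"
  have "\<kappa> ^ (m + 1) \<le> \<kappa> ^ 1" using \<kappa> by (intro power_decreasing) auto
  also have "\<dots> \<le> c\<^sub>0 ^ m" using \<kappa> c\<^sub>0 by simp
  also have "\<dots> \<le> c\<^sub>0 ^ card ?J" using c\<^sub>0 e(2) by (intro power_decreasing) auto
  also have "\<dots> = (\<Prod>j\<in>?J. c\<^sub>0)" by simp
  also have "\<dots> \<le> (\<Prod>j\<in>?J. w j)" using w_ge c\<^sub>0 by (intro prod_mono) auto
  also have "\<dots> = (\<Sum>t\<in>PiE ?J P. \<Prod>j\<in>?J. x (t j))"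
    unfolding w_def using finite_P by (intro sum_tuples[symmetric]) auto
  finally have large: "\<kappa> ^ (m + 1) \<le> (\<Sum>t\<in>PiE ?J P. \<Prod>j\<in>?J. x (t j))" .
  have us: "\<And>u'. u' \<in> {u, y} \<Longrightarrow> u' \<in> P i" "finite {u, y}" "card {u, y} \<le> 2"
    using u by auto
  obtain t where t: "t \<in> PiE ?J P"
    "\<And>R. R \<in> nsets ?J (r - 1) \<Longrightarrow> insert u (t ` R) \<in> \<E>"
    "\<And>R. R \<in> nsets ?J (r - 1) \<Longrightarrow> insert y (t ` R) \<in> \<E>"
    "nsets (insert u (t ` ?J)) r \<subseteq> \<E>" "card (insert u (t ` ?J)) = m"
    "insert u (t ` ?J) \<subseteq> T" "y \<in> T" "y \<notin> t ` ?J"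
    using complete_tuple[OF e(2) us order_refl large] by auto
  \<comment> \<open>Every index lies in some \<open>(r - 1)\<close>-set, so \<open>y\<close> shares
    an edge with every \<open>t j\<close>. The pair \<open>u\<close>, \<open>y\<close> is covered by
    \<open>e\<close>, which may leave \<open>T\<close>.\<close>
  have ext: "\<exists>R\<in>nsets ?J (r - 1). j \<in> R" if "j \<in> ?J" for j
  proof -
    have "card {j} \<le> r - 1" "r - 1 \<le> card ?J" "{j} \<subseteq> ?J" using that r_ge r_le e by auto
    then obtain R where "{j} \<subseteq> R" "R \<subseteq> ?J" "card R = r - 1"
      using exists_subset_between[of "{j}" "r - 1" ?J] by auto
    then show ?thesis using finite_subset[of R ?J] by (auto simp: nsets_def)
  qed
  have "card ?J \<noteq> 0" using r_ge r_le e(2) by simp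
  then have "?J \<noteq> {}" by (metis card.empty)
  then obtain j R where R: "R \<in> nsets ?J (r - 1)" "j \<in> R" using ext by blast
  have U: "insert u (t ` ?J) \<subseteq> V" "y \<in> V" "y \<notin> insert u (t ` ?J)" using t(6-8) T u by auto
  have "t ` R \<subseteq> insert u (t ` ?J)" using R(1) by (auto simp: nsets_def)
  then obtain z where z: "z \<in> insert u (t ` ?J)" "\<forall>e\<in>\<E>. \<not> (z \<in> e \<and> y \<in> e)"
    using no_core[OF U(1) t(5,4) U(2,3) _ t(3)[OF R(1)]] by blast
  then consider "z = u" | j where "j \<in> ?J" "z = t j" by blast
  then show False
  proof cases
    case 1 then show ?thesis using z u e by auto
  next
    case 2
    then obtain S where S: "S \<in> nsets ?J (r - 1)" "j \<in> S" using ext by blast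
    have "z \<in> insert y (t ` S)" using 2 S(2) by simp
    then show ?thesis using bspec[OF z(2) t(3)[OF S(1)]] by simp
  qed
qed

end

section \<open>Neighbourhoods of a vertex outside the partition\<close>

context partite_subset
begin

definition nbr :: "'a \<Rightarrow> nat \<Rightarrow> 'a set" where
  "nbr v j = {a \<in> P j. \<exists>e\<in>\<E>. v \<in> e \<and> a \<in> e}"

lemma nbr_subset: "nbr v j \<subseteq> P j"
  by (auto simp: nbr_def)

lemma finite_nbr: "j < m \<Longrightarrow> finite (nbr v j)"
  using finite_subset[OF nbr_subset finite_P] .

lemma disj_nbr: "disjoint_family_on (nbr v) {..<m}"
  using disj nbr_subset[of v] unfolding disjoint_family_on_def by blast

lemma sum_nbr: "0 \<le> sum x (nbr v j)" "j < m \<Longrightarrow> sum x (nbr v j) \<le> w j"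
proof -
  show "0 \<le> sum x (nbr v j)" using prob(1) by (simp add: sum_nonneg)
  show "sum x (nbr v j) \<le> w j" if "j < m"
    unfolding w_def using prob(1) that by (intro sum_mono2 finite_P nbr_subset)
qed

text \<open>For \<open>v\<close> outside \<open>T\<close> the edges at \<open>v\<close> are not
  inside \<open>T\<close>, so \<open>P_edges\<close> says nothing about them;
  \<open>edge_transversal\<close>, which holds for arbitrary edges, takes its place.\<close>

lemma transversal_L_nbr: "transversal_family (nbr v) {..<m} (r - 1) (L v)"
  unfolding transversal_family_def
proof (intro ballI conjI)
  fix f assume f: "f \<in> L v"
  note f' = L_mem[OF f]
  show "f \<subseteq> (\<Union>j<m. nbr v j)"
  proof
    fix a assume a: "a \<in> f"
    then obtain j where "j < m" "a \<in> P j" using f' P_Un by blast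
    moreover have "\<exists>e\<in>\<E>. v \<in> e \<and> a \<in> e" using f' a by blast
    ultimately show "a \<in> (\<Union>j<m. nbr v j)" by (auto simp: nbr_def)
  qed
  show "card f = r - 1" "finite f" using f' by auto
  fix j assume "j \<in> {..<m}"
  then have "card (insert v f \<inter> P j) \<le> 1" using f' edge_transversal by auto
  moreover have "card (f \<inter> nbr v j) \<le> card (insert v f \<inter> P j)"
    using f' nbr_subset[of v j] by (intro card_mono) auto
  ultimately show "card (f \<inter> nbr v j) \<le> 1" by simp
qed

text \<open>Averaging: the link of \<open>v\<close> splits over at most \<open>2 ^ m\<close> index
  sets.\<close>

lemma heavy_index_set:
  assumes "low \<le> wt x (L v)"
  obtains I where "I \<in> nsets {..<m} (r - 1)"
    "\<kappa> \<le> (\<Sum>s | s \<in> PiE I (nbr v) \<and> s ` I \<in> L v. \<Prod>j\<in>I. x (s j))"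
proof -
  let ?hit = "\<lambda>I. \<Sum>s | s \<in> PiE I (nbr v) \<and> s ` I \<in> L v. \<Prod>j\<in>I. x (s j)"
  have "\<exists>I\<in>nsets {..<m} (r - 1). \<kappa> \<le> ?hit I"
  proof (rule ccontr)
    assume "\<not> ?thesis"
    then have small: "?hit I < \<kappa>" if "I \<in> nsets {..<m} (r - 1)" for I using that by auto
    have "nsets {..<m} (r - 1) \<noteq> {}" using r_le by (simp add: nsets_eq_empty_iff)
    then have "(\<Sum>I\<in>nsets {..<m} (r - 1). ?hit I) < (\<Sum>I\<in>nsets {..<m} (r - 1). \<kappa>)"
      using small by (intro sum_strict_mono finite_imp_finite_nsets) auto
    also have "\<dots> = real (card (nsets {..<m} (r - 1))) * \<kappa>" by simp
    also have "\<dots> \<le> 2 ^ m * \<kappa>"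
    proof -
      have "card (nsets {..<m} (r - 1)) \<le> card (Pow {..<m})"
        by (intro card_mono) (auto simp: nsets_def)
      then have "real (card (nsets {..<m} (r - 1))) \<le> 2 ^ m"
        using of_nat_mono by (fastforce simp: card_Pow)
      then show ?thesis using \<kappa> by (intro mult_right_mono) auto
    qed
    also have "2 ^ m * \<kappa> \<le> 2 ^ m * (\<mu> / (2 * fact (r - 1) * 2 ^ m))"
      using \<kappa> by (intro mult_left_mono) auto
    also have "\<dots> = \<mu> / (2 * fact (r - 1))" by simp
    also have "\<dots> \<le> low" by (rule low)
    also have "low \<le> wt x (L v)" by fact
    also have "\<dots> \<le> (\<Sum>I\<in>nsets {..<m} (r - 1). ?hit I)"
      by (rule wt_le_tuples[where x = x, OF _ disj_nbr _ prob(1) finite_L transversal_L_nbr])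
        (use finite_nbr in auto)
    finally show False by simp
  qed
  then show thesis using that by blast
qed

text \<open>Two parts with few neighbours of \<open>v\<close> would make the link of \<open>v\<close> lighter than the link of a
  vertex of one of these parts by almost the contribution of the other part.\<close>
lemma light_index_unique:
  assumes v: "low \<le> wt x (L v)" and jk: "j < m" "k < m" "j \<noteq> k"
  shows "\<kappa> \<le> sum x (nbr v j) \<or> \<kappa> \<le> sum x (nbr v k)"
proof (rule ccontr)
  assume "\<not> ?thesis"
  then have small: "sum x (nbr v j) < \<kappa>" "sum x (nbr v k) < \<kappa>" by auto
  obtain p where p: "r - 1 = Suc p" using r_ge by (metis One_nat_def Suc_diff_le Suc_1 diff_Suc_Suc diff_zero)
  let ?a = "\<lambda>j. sum x (nbr v j)"
  define J where "J = {..<m} - {j, k}"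
  have sets: "{..<m} = insert j (insert k J)" "{..<m} - {j} = insert k J" "j \<notin> insert k J" "k \<notin> J" "finite J"
    using jk by (auto simp: J_def)
  have a_le: "?a i \<le> w i" if "i \<in> {..<m}" for i using sum_nbr(2) that by auto
  have sum_a: "sum ?a S \<le> 1" if "S \<subseteq> {..<m}" for S
  proof -
    have "sum ?a S \<le> sum w S" using a_le that by (intro sum_mono) auto
    also have "\<dots> \<le> sum w {..<m}" using that w_nonneg by (intro sum_mono2) auto
    finally show ?thesis using sum_w sum_T_le by simp
  qed
  have "low \<le> wt ?a (nsets {..<m} (r - 1))"
    using v wt_le_parts[where x = x, OF _ disj_nbr _ prob(1) finite_L transversal_L_nbr, of v] finite_nbr
    by force
  also have "\<dots> = ?a j * wt ?a (nsets (insert k J) p) + (?a k * wt ?a (nsets J p) + wt ?a (nsets J (Suc p)))"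
    unfolding p by (subst sets(1)) (use sets(3-) in \<open>simp add: wt_nsets_insert\<close>)
  also have "\<dots> \<le> \<kappa> * 1 + (\<kappa> * 1 + wt w (nsets J (Suc p)))"
  proof (intro add_mono mult_mono)
    show "wt ?a (nsets (insert k J) p) \<le> 1"
      using sum_a[of "insert k J"] jk sets(5) by (intro wt_nsets_le_1) (auto simp: sum_nbr J_def)
    show "wt ?a (nsets J p) \<le> 1"
      using sum_a[of J] sets(5) by (intro wt_nsets_le_1) (auto simp: sum_nbr J_def)
    show "wt ?a (nsets J (Suc p)) \<le> wt w (nsets J (Suc p))"
      unfolding wt_def using sum_nbr by (intro sum_mono prod_mono) (auto simp: nsets_def J_def)
  qed (use small \<kappa> in \<open>auto intro!: wt_nonneg simp: sum_nbr\<close>)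
  finally have 1: "low \<le> 2 * \<kappa> + wt w (nsets J (Suc p))" by simp
  have "w k * wt w (nsets J p) + wt w (nsets J (Suc p)) = wt w (nsets ({..<m} - {j}) (r - 1))"
    unfolding p sets(2) using sets(3-) by (simp add: wt_nsets_insert)
  also have "\<dots> \<le> low + \<beta>" using jk(1) by (rule esym_le_low)
  finally have "w k * wt w (nsets J p) \<le> \<beta> + 2 * \<kappa>" using 1 by simp
  \<comment> \<open>Both \<beta> and \<kappa> are at most a quarter of \<open>c\<^sub>0 ^ m\<close>,
    whereas the contribution of part \<open>k\<close> is at least \<open>c\<^sub>0\<close> to the
    power \<open>r - 1\<close>.\<close>
  also have "\<dots> \<le> 3 * (c\<^sub>0 ^ m / 4)" using \<beta> \<kappa> by simp
  also have "\<dots> < c\<^sub>0 ^ m" using c\<^sub>0 by simp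
  also have "\<dots> \<le> c\<^sub>0 ^ Suc p" using c\<^sub>0 r_le p by (intro power_decreasing) auto
  also have "\<dots> = c\<^sub>0 * c\<^sub>0 ^ p" by simp
  also have "\<dots> \<le> w k * wt w (nsets J p)"
  proof (intro mult_mono)
    show "c\<^sub>0 \<le> w k" using jk by (intro w_ge)
    have "card J = m - 2" using jk by (simp add: card_Diff_subset J_def)
    then have "nsets J p \<noteq> {}" using p r_le sets(5) by (simp add: nsets_eq_empty_iff)
    then obtain R where R: "R \<in> nsets J p" by blast
    then have R': "R \<subseteq> {..<m}" "card R = p" by (auto simp: nsets_def J_def)
    then have "c\<^sub>0 ^ p = (\<Prod>j\<in>R. c\<^sub>0)" by simp
    also have "\<dots> \<le> (\<Prod>j\<in>R. w j)" using w_ge c\<^sub>0 R' by (intro prod_mono) auto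
    also have "\<dots> \<le> wt w (nsets J p)"
      unfolding wt_def using R w_nonneg sets(5) by (intro member_le_sum finite_imp_finite_nsets prod_nonneg) auto
    finally show "c\<^sub>0 ^ p \<le> wt w (nsets J p)" .
  qed (use c\<^sub>0 w_nonneg in auto)
  finally show False by simp
qed

lemma missed_part:
  assumes v: "v \<in> V" "v \<notin> T" "low \<le> wt x (L v)"
  shows "\<exists>i<m. nbr v i = {}"
proof (rule ccontr)
  assume "\<not> ?thesis"
  then have ne: "nbr v i \<noteq> {}" if "i < m" for i using that by blast
  obtain I where I: "I \<in> nsets {..<m} (r - 1)"
    "\<kappa> \<le> (\<Sum>s | s \<in> PiE I (nbr v) \<and> s ` I \<in> L v. \<Prod>j\<in>I. x (s j))"
    using heavy_index_set[OF v(3)] by blast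
  have I': "I \<subseteq> {..<m}" "card I = r - 1" using I by (auto simp: nsets_def)
  have "\<not> {..<m} \<subseteq> I"
  proof
    assume "{..<m} \<subseteq> I"
    then have "I = {..<m}" using I' by auto
    then show False using I' r_le r_ge by simp
  qed
  then obtain k' where k': "k' < m" "k' \<notin> I" by auto
  \<comment> \<open>If a light part lies outside \<open>I\<close>, it becomes \<open>k\<close>, and
    by \<open>light_index_unique\<close> no other part is light. Otherwise any index outside
    \<open>I\<close> will do.\<close>
  obtain k where k: "k < m" "k \<notin> I" "\<And>j. j < m \<Longrightarrow> j \<noteq> k \<Longrightarrow> j \<notin> I \<Longrightarrow> \<kappa> \<le> sum x (nbr v j)"
  proof (cases "\<exists>k<m. k \<notin> I \<and> sum x (nbr v k) < \<kappa>")
    case True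
    then obtain k where k: "k < m" "k \<notin> I" "sum x (nbr v k) < \<kappa>" by blast
    show thesis
    proof (rule that[OF k(1,2)])
      fix j assume j: "j < m" "j \<noteq> k"
      show "\<kappa> \<le> sum x (nbr v j)" using light_index_unique[OF v(3) j(1) k(1) j(2)] k(3) by linarith
    qed
  next
    case False
    then show thesis using that[OF k'] by force
  qed
  \<comment> \<open>Nothing but nonemptiness is known of \<open>nbr v k\<close>, so \<open>u\<close>
    is picked by hand and \<open>complete_tuple\<close> adapts the other coordinates to it.\<close>
  obtain u where u: "u \<in> nbr v k" using ne[OF k(1)] by blast
  let ?J = "{..<m} - {k}"
  let ?B = "{s. s \<in> PiE I (nbr v) \<and> s ` I \<in> L v}"
  \<comment> \<open>Tuples of neighbours of \<open>v\<close> that contain an edge of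
    \<open>v\<close> over \<open>I\<close>: the coordinates in \<open>I\<close> contribute a factor
    of at least \<kappa>, and so does each remaining part.\<close>
  define Q where "Q = {t. t \<in> PiE ?J (nbr v) \<and> restrict t I \<in> ?B}"
  have IJ: "I \<subseteq> ?J" using I' k(2) by auto
  have "\<kappa> ^ (m + 1) = \<kappa> * \<kappa> ^ m" by simp
  also have "\<dots> \<le> (\<Sum>s\<in>?B. \<Prod>j\<in>I. x (s j)) * (\<Prod>j\<in>?J - I. sum x (nbr v j))"
  proof (intro mult_mono)
    have "card (?J - I) \<le> card {..<m}" by (intro card_mono) auto
    then have "\<kappa> ^ m \<le> \<kappa> ^ card (?J - I)" using \<kappa> by (intro power_decreasing) auto
    also have "\<dots> = (\<Prod>j\<in>?J - I. \<kappa>)" by simp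
    also have "\<dots> \<le> (\<Prod>j\<in>?J - I. sum x (nbr v j))" using k(3) \<kappa> by (intro prod_mono) auto
    finally show "\<kappa> ^ m \<le> (\<Prod>j\<in>?J - I. sum x (nbr v j))" .
  qed (use I \<kappa> prob in \<open>auto intro!: sum_nonneg prod_nonneg\<close>)
  also have "\<dots> = (\<Sum>t\<in>Q. \<Prod>j\<in>?J. x (t j))"
    unfolding Q_def by (rule sum_cylinder[symmetric]) (use IJ finite_nbr in auto)
  finally have large: "\<kappa> ^ (m + 1) \<le> (\<Sum>t\<in>Q. \<Prod>j\<in>?J. x (t j))" .
  have "PiE ?J (nbr v) \<subseteq> PiE ?J P" using nbr_subset by (intro PiE_mono) auto
  then have QP: "Q \<subseteq> PiE ?J P" by (auto simp: Q_def)
  have us: "\<And>u'. u' \<in> {u} \<Longrightarrow> u' \<in> P k" "finite {u}" "card {u} \<le> 2" using u nbr_subset by auto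
  obtain t where t: "t \<in> Q" "nsets (insert u (t ` ?J)) r \<subseteq> \<E>" "card (insert u (t ` ?J)) = m"
    "insert u (t ` ?J) \<subseteq> T"
    using complete_tuple[OF k(1) us QP large] by auto
  have img: "restrict t I ` I = t ` I" by simp
  have tI: "t ` I \<in> L v" using t(1) img by (simp add: Q_def)
  have tJ: "t j \<in> nbr v j" if "j \<in> ?J" for j using t(1) that by (auto simp: Q_def dest: PiE_mem)
  have U: "insert u (t ` ?J) \<subseteq> V" "v \<notin> insert u (t ` ?J)" "t ` I \<subseteq> insert u (t ` ?J)"
    using t(4) T v IJ by auto
  have "\<exists>z\<in>insert u (t ` ?J). \<forall>e\<in>\<E>. \<not> (z \<in> e \<and> v \<in> e)"
    using no_core[OF U(1) t(3,2) v(1) U(2,3)] L_mem[OF tI] by blast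
  moreover have "\<exists>e\<in>\<E>. z \<in> e \<and> v \<in> e" if "z \<in> insert u (t ` ?J)" for z
    using that u tJ by (auto simp: nbr_def)
  ultimately show False by blast
qed

lemma partite_on_insert:
  assumes v: "v \<in> V" "v \<notin> T" "low \<le> wt x (L v)"
  shows "partite_on (insert v T)"
proof -
  obtain i where i: "i < m" "nbr v i = {}" using missed_part[OF v] by blast
  let ?P = "P(i := insert v (P i))"
  show ?thesis unfolding partite_on_def
  proof (intro exI[of _ ?P] conjI ballI impI allI)
    show "disjoint_family_on ?P {..<m}"
      unfolding disjoint_family_on_def
    proof (intro ballI impI)
      fix a b assume ab: "a \<in> {..<m}" "b \<in> {..<m}" "a \<noteq> b"
      have "P a \<inter> P b = {}" using disj ab by (rule disjoint_family_onD)
      moreover have "v \<notin> P a" "v \<notin> P b" using ab v(2) P_subset by blast+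
      ultimately show "?P a \<inter> ?P b = {}" using ab by auto
    qed
    show "(\<Union>j<m. ?P j) = insert v T" using i P_Un by (auto split: if_splits)
    fix e j assume e: "e \<in> \<E>" "e \<subseteq> insert v T" "j < m"
    show "card (e \<inter> ?P j) \<le> 1"
    proof (cases "j = i \<and> v \<in> e")
      case True
      then have "e \<inter> P i = {}" using i e(1) by (auto simp: nbr_def)
      then have "e \<inter> ?P j = {v}" using True by auto
      then show ?thesis by simp
    next
      case False
      then have "e \<inter> ?P j = e \<inter> P j" by auto
      then show ?thesis using edge_transversal[OF e(1,3)] by simp
    qed
  qed
qed

end

subsection \<open>Stability of weights\<close>

context coreless
begin

text \<open>Setting the weights outside \<open>T\<close> to zero costs at most their sum, because
  the link of a link has weight at most \<open>1\<close>.\<close>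

lemma link_restrict:
  assumes "prob x" "T \<subseteq> V"
  shows "wt x (link \<E> v) \<le> wt x {f \<in> link \<E> v. f \<subseteq> T} + sum x (V - T)"
proof -
  define y where "y = (\<lambda>i. if i \<in> V - T then 0 else x i)"
  have fin: "finite (link \<E> v)" by (rule finite_link[OF finite_\<E>])
  have sub: "f \<subseteq> V \<and> finite f \<and> card f = r - 1" if "f \<in> link \<E> v" for f
  proof -
    have f: "insert v f \<in> \<E>" "v \<notin> f" using that by (auto simp: link_def)
    from edges[OF f(1)] finite_edge[OF f(1)] f(2) show ?thesis by auto
  qed
  have "wt x (link \<E> v) \<le> wt y (link \<E> v) + (\<Sum>j\<in>V - T. (x j - y j) * wt x (link (link \<E> v) j))"
    using sub fin finite_V assms by (intro wt_decrease) (auto simp: y_def)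
  also have "(\<Sum>j\<in>V - T. (x j - y j) * wt x (link (link \<E> v) j)) \<le> (\<Sum>j\<in>V - T. x j * 1)"
  proof (rule sum_mono)
    fix j assume j: "j \<in> V - T"
    have "wt x (link (link \<E> v) j) \<le> 1"
    proof (rule wt_le_1[OF finite_V])
      fix g assume "g \<in> link (link \<E> v) j"
      then have "insert j g \<in> link \<E> v" "j \<notin> g" by (auto simp: link_def)
      then show "g \<subseteq> V \<and> card g = r - 2" using sub[of "insert j g"] by auto
    qed (use assms in auto)
    then show "(x j - y j) * wt x (link (link \<E> v) j) \<le> x j * 1"
      using j assms(1) by (auto simp: y_def mult_left_le)
  qed
  also have "wt y (link \<E> v) = wt y {f \<in> link \<E> v. f \<subseteq> T}"
    unfolding wt_def
  proof (rule sum.mono_neutral_right[OF fin])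
    show "\<forall>f\<in>link \<E> v - {f \<in> link \<E> v. f \<subseteq> T}. prod y f = 0"
    proof
      fix f assume f: "f \<in> link \<E> v - {f \<in> link \<E> v. f \<subseteq> T}"
      then obtain j where "j \<in> f" "j \<in> V - T" using sub by blast
      then show "prod y f = 0" using f sub[of f] by (intro prod_zero) (auto simp: y_def)
    qed
  qed auto
  also have "\<dots> \<le> wt x {f \<in> link \<E> v. f \<subseteq> T}"
    using assms(1) by (intro wt_le_fun) (auto simp: y_def)
  finally show ?thesis by simp
qed

text \<open>Vertices are added one at a time. The weight outside the growing set only decreases, so
  one \<sigma> works throughout, and the partition may be chosen anew at each step. Degrees inside
  the set differ from full degrees by at most \<tau>, hence the factor
  \<open>fact (r - 1)\<close>.\<close>

lemma partite_on_Un: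
  assumes "prob x" "T \<subseteq> V" "partite_on T" "1 - \<tau> \<le> sum x T" "W \<subseteq> V"
    and high: "\<And>v. v \<in> T \<union> W \<Longrightarrow> (turan_density m r - \<eta>) / fact (r - 1) \<le> wt x (link \<E> v)"
    and \<sigma>: "\<eta> + fact (r - 1) * \<tau> \<le> \<sigma>" "\<tau> \<le> \<sigma>" "0 \<le> \<sigma>" "\<sigma> \<le> \<sigma>\<^sub>0"
  shows "partite_on (T \<union> W)"
proof -
  have "finite W" using assms(5) finite_V finite_subset by blast
  then show ?thesis using assms(5) high
  proof (induction W rule: finite_induct)
    case empty
    then show ?case using assms(3) by simp
  next
    case (insert v W)
    let ?T = "T \<union> W"
    show ?case
    proof (cases "v \<in> ?T")
      case True
      then show ?thesis using insert by (simp add: insert_absorb)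
    next
      case False
      have T: "?T \<subseteq> V" using insert.prems assms(2) by auto
      have "partite_on ?T" using insert by auto
      then obtain P :: "nat \<Rightarrow> 'a set" where P: "disjoint_family_on P {..<m}" "(\<Union>i<m. P i) = ?T"
        "\<forall>e\<in>\<E>. e \<subseteq> ?T \<longrightarrow> (\<forall>i<m. card (e \<inter> P i) \<le> 1)"
        unfolding partite_on_def by blast
      have "sum x T \<le> sum x ?T" using T finite_V assms(1) finite_subset by (intro sum_mono2) auto
      then have sumT: "1 - \<tau> \<le> sum x ?T" using assms(4) by simp
      moreover have "sum x V = sum x (V - ?T) + sum x ?T"
        using T finite_V by (rule sum.subset_diff)
      ultimately have out: "sum x (V - ?T) \<le> \<tau>" using assms(1) by simp
      have high': "(turan_density m r - \<sigma>) / fact (r - 1) \<le> wt x {f \<in> link \<E> u. f \<subseteq> ?T}"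
        if "u \<in> insert v ?T" for u
      proof -
        have "(turan_density m r - \<eta>) / fact (r - 1) \<le> wt x {f \<in> link \<E> u. f \<subseteq> ?T} + \<tau>"
          using insert.prems(2)[of u] that link_restrict[OF assms(1) T, of u] out by auto
        moreover have "(turan_density m r - \<sigma>) / fact (r - 1) \<le> (turan_density m r - \<eta> - fact (r - 1) * \<tau>) / fact (r - 1)"
          using \<sigma> by (intro divide_right_mono) auto
        moreover have "\<dots> = (turan_density m r - \<eta>) / fact (r - 1) - \<tau>" by (simp add: diff_divide_distrib)
        ultimately show ?thesis by simp
      qed
      interpret partite_subset V \<E> m r \<rho> x ?T P \<sigma>
        by unfold_locales (use assms(1) T P \<sigma> sumT high' in auto)
      have "partite_on (insert v ?T)"
        using insert.prems False high'[of v] by (intro partite_on_insert) (auto simp: low_def L_def)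
      then show ?thesis by simp
    qed
  qed
qed

definition stable_at :: "real \<Rightarrow> ('a \<Rightarrow> real) \<Rightarrow> bool" where
  "stable_at \<epsilon> x \<longleftrightarrow> (\<exists>S\<subseteq>V. partite_on S \<and> sum x (V - S) \<le> \<epsilon>)"

text \<open>The exceptional set can always be replaced by the set of vertices of low degree, so its
  weight does not accumulate when this is applied repeatedly.\<close>
lemma stable_at_improve:
  assumes "prob x" "0 < \<epsilon>" "\<epsilon> < 1" "(2 * real r ^ 2 + 3 * fact r) * \<epsilon> \<le> \<sigma>\<^sub>0"
    and wt: "(turan_density m r - \<epsilon>\<^sup>2) / fact r \<le> wt x \<E>"
    and "stable_at (2 * \<epsilon>) x"
  shows "stable_at \<epsilon> x"
proof -
  obtain S where S: "S \<subseteq> V" "partite_on S" "sum x (V - S) \<le> 2 * \<epsilon>"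
    using assms(6) unfolding stable_at_def by blast
  let ?\<eta> = "2 * real r ^ 2 * \<epsilon>"
  define Z where "Z = {v \<in> V. wt x (link \<E> v) < (turan_density m r - ?\<eta>) / fact (r - 1)}"
  have Z: "sum x Z < \<epsilon>"
    by (rule low_degree_weight[OF assms(1-3) wt]) (auto simp: Z_def)
  have "V - (S - Z) \<subseteq> (V - S) \<union> Z" by (auto)
  then have "sum x (V - (S - Z)) \<le> sum x ((V - S) \<union> Z)"
    using finite_V assms(1) by (intro sum_mono2) (auto simp: Z_def)
  also have "\<dots> \<le> sum x (V - S) + sum x Z"
    using finite_V assms(1) by (simp add: sum_Un sum_nonneg Z_def)
  finally have "sum x (V - (S - Z)) \<le> 3 * \<epsilon>" using S Z by simp
  moreover have "sum x V = sum x (V - (S - Z)) + sum x (S - Z)"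
    using S(1) finite_V by (intro sum.subset_diff) auto
  ultimately have sumT: "1 - 3 * \<epsilon> \<le> sum x (S - Z)" using assms(1) by simp
  have fact_le: "fact (r - 1) \<le> (fact r :: real)" by (rule fact_mono) auto
  \<comment> \<open>Low-degree vertices are first removed from \<open>S\<close>, since every vertex
    of the partite set needs high degree. In the constant, \<open>2 * real r ^ 2\<close> comes from
    the degree threshold and \<open>3 * fact r\<close> covers the lost weight
    \<open>3 * \<epsilon>\<close>.\<close>
  have "partite_on ((S - Z) \<union> (V - Z))"
  proof (rule partite_on_Un[OF assms(1) _ _ sumT])
    show "partite_on (S - Z)" using S(2) by (rule partite_on_subset) auto
    show "(turan_density m r - ?\<eta>) / fact (r - 1) \<le> wt x (link \<E> v)" if "v \<in> (S - Z) \<union> (V - Z)" for v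
      using that S(1) by (auto simp: Z_def not_less)
    have "fact (r - 1) * (3 * \<epsilon>) \<le> fact r * (3 * \<epsilon>)" using fact_le assms(2) by (intro mult_right_mono) auto
    then show "?\<eta> + fact (r - 1) * (3 * \<epsilon>) \<le> (2 * real r ^ 2 + 3 * fact r) * \<epsilon>" by (simp add: algebra_simps)
    have "1 * (3 * \<epsilon>) \<le> fact r * (3 * \<epsilon>)"
      using assms(2) by (intro mult_right_mono fact_ge_1) auto
    moreover have "0 \<le> ?\<eta>" using assms(2) by simp
    ultimately show "3 * \<epsilon> \<le> (2 * real r ^ 2 + 3 * fact r) * \<epsilon>" by (simp add: algebra_simps)
    show "0 \<le> (2 * real r ^ 2 + 3 * fact r) * \<epsilon>" using assms(2) by simp
  qed (use S assms in auto)
  moreover have "(S - Z) \<union> (V - Z) = V - Z" using S(1) by auto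
  moreover have "V - (V - Z) = Z" by (auto simp: Z_def)
  ultimately show ?thesis unfolding stable_at_def using Z by (intro exI[of _ "V - Z"]) auto
qed

lemma partite_on_small:
  assumes "finite S" "card S \<le> m" shows "partite_on S"
proof -
  obtain f :: "'a \<Rightarrow> nat" where f: "inj_on f S" "f ` S \<subseteq> {..<m}"
    using assms inj_on_iff_card_le[OF assms(1), of "{..<m}"] by auto
  show ?thesis unfolding partite_on_def
  proof (intro exI[of _ "\<lambda>i. {a \<in> S. f a = i}"] conjI ballI impI allI)
    show "disjoint_family_on (\<lambda>i. {a \<in> S. f a = i}) {..<m}" by (auto simp: disjoint_family_on_def)
    show "(\<Union>i<m. {a \<in> S. f a = i}) = S" using f by auto
    fix e i
    have "\<forall>a\<in>e \<inter> {a \<in> S. f a = i}. \<forall>b\<in>e \<inter> {a \<in> S. f a = i}. a = b"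
      using f(1) by (auto simp: inj_on_def)
    then show "card (e \<inter> {a \<in> S. f a = i}) \<le> 1"
      using assms(1) card_le_Suc0_iff_eq[of "e \<inter> {a \<in> S. f a = i}"] by auto
  qed
qed

text \<open>Weight is moved in portions of at most \<open>\<epsilon>\<close>, so that each step changes the weight of the
  exceptional set by at most \<open>\<epsilon>\<close>.\<close>
lemma stable_at:
  assumes "prob x" "(turan_density m r - \<epsilon>\<^sup>2) / fact r \<le> wt x \<E>"
    and \<epsilon>: "0 < \<epsilon>" "\<epsilon> < 1" "(2 * real r ^ 2 + 3 * fact r) * \<epsilon> \<le> \<sigma>\<^sub>0" "\<rho> < turan_density m r - \<epsilon>\<^sup>2"
  shows "stable_at \<epsilon> x"
  using assms(1,2)
proof (induction rule: symmetrization_induct)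
  case (covered x)
  let ?S = "{i \<in> V. x i \<noteq> 0}"
  have S: "sum x ?S = 1" "wt x {e \<in> \<E>. e \<subseteq> ?S} = wt x \<E>" "finite ?S"
    using covered wt_support[OF refl, of x] sum_support[OF refl, of x] finite_V by auto
  have "card ?S \<le> m"
  proof (rule ccontr)
    assume "\<not> card ?S \<le> m"
    then have "fact r * wt x {e \<in> \<E>. e \<subseteq> ?S} \<le> \<rho>"
      using covered S by (intro sparse) auto
    then have "fact r * wt x \<E> < turan_density m r - \<epsilon>\<^sup>2" using S \<epsilon> by simp
    with covered(3) show False by (simp add: field_simps)
  qed
  then have "partite_on ?S" using S by (intro partite_on_small)
  moreover have "sum x (V - ?S) = 0" by (intro sum.neutral) auto
  ultimately show ?case unfolding stable_at_def using \<epsilon> by (intro exI[of _ ?S]) auto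
next
  case (transfer x u v)
  let ?y = "\<lambda>t. x(u := x u + t, v := x v - t)"
  have wt_y: "(turan_density m r - \<epsilon>\<^sup>2) / fact r \<le> wt (?y t) \<E>" if "0 \<le> t" for t
    using wt_transfer[OF transfer(4,5,6) that] transfer(8) by linarith
  \<comment> \<open>Here \<open>n\<close> bounds the number of portions still to be moved. At
    \<open>n = 0\<close> all weight of \<open>v\<close> has reached \<open>u\<close>, and the
    symmetrization hypothesis applies; larger \<open>n\<close> leads back towards the start.\<close>
  have "stable_at \<epsilon> (?y t)" if "0 \<le> t" "t \<le> x v" "x v - t \<le> real n * \<epsilon>" for t n
    using that
  proof (induction n arbitrary: t)
    case 0
    then have t: "t = x v" "0 \<le> x v" by auto
    show ?case unfolding t(1) by (rule transfer(7)[OF wt_y[OF t(2)]])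
  next
    case (Suc n)
    define t' where "t' = min (t + \<epsilon>) (x v)"
    have t': "t \<le> t'" "t' \<le> t + \<epsilon>" "t' \<le> x v" "x v - t' \<le> real n * \<epsilon>" "0 \<le> t'"
      using Suc.prems \<epsilon> by (auto simp: t'_def min_def algebra_simps)
    from Suc.IH[OF t'(5,3,4)] obtain S where S: "S \<subseteq> V" "partite_on S" "sum (?y t') (V - S) \<le> \<epsilon>"
      unfolding stable_at_def by blast
    \<comment> \<open>Going back from \<open>t'\<close> to \<open>t\<close> raises only the weight
      of \<open>v\<close>, by at most \<epsilon>.\<close>
    have "sum (?y t) (V - S) \<le> (\<Sum>i\<in>V - S. ?y t' i + (if i = v then \<epsilon> else 0))"
      using t' \<epsilon> by (intro sum_mono) auto
    also have "\<dots> \<le> sum (?y t') (V - S) + \<epsilon>"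
      unfolding sum.distrib using finite_V \<epsilon> by auto
    finally have "stable_at (2 * \<epsilon>) (?y t)" unfolding stable_at_def using S by (intro exI[of _ S]) auto
    moreover have "prob (?y t)"
    proof
      show "\<forall>i. 0 \<le> ?y t i" using transfer(1) Suc.prems by auto
      show "sum (?y t) V = 1" by (subst sum_transfer) (use transfer in auto)
    qed
    ultimately show ?case using stable_at_improve \<epsilon> wt_y Suc.prems by blast
  qed
  from this[of 0 "nat \<lceil>x v / \<epsilon>\<rceil>"] have "stable_at \<epsilon> (?y 0)"
    using transfer(1) \<epsilon> by (simp add: pos_divide_le_eq[symmetric] real_nat_ceiling_ge del: pos_divide_le_eq)
  then show ?case by simp
qed

end

subsection \<open>Lagrangians and free hypergraphs\<close>

lemma lagrange_poly_wt: "lagrange_poly r G x = fact r * wt x (edges G)"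
  by (simp add: lagrange_poly_def wt_def)

text \<open>A crude bound, whose purpose is to make the sets behind both suprema bounded.\<close>

lemma lagrange_poly_le_fact:
  assumes "r_graph r G" "\<forall>i\<in>vertices G. 0 \<le> x i" "sum x (vertices G) = 1"
  shows "lagrange_poly r G x \<le> fact r"
proof -
  \<comment> \<open>The weight lemmas ask for nonnegativity everywhere, the Lagrangian only on the
    vertices.\<close>
  let ?x = "\<lambda>i. if i \<in> vertices G then x i else 0"
  have G: "finite (vertices G)" "\<And>e. e \<in> edges G \<Longrightarrow> e \<subseteq> vertices G \<and> card e = r"
    using assms(1) by (auto simp: r_graph_def)
  have "sum ?x (vertices G) = sum x (vertices G)" by (rule sum.cong) auto
  then have "wt ?x (edges G) \<le> 1"
    using assms G by (intro wt_le_1[OF G(1) _ _ G(2)]) auto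
  moreover have "wt ?x (edges G) = wt x (edges G)" by (rule wt_cong) (use G(2) in auto)
  ultimately show ?thesis by (simp add: lagrange_poly_wt)
qed

lemma lagrange_poly_le_lagrangian:
  assumes "r_graph r G" "\<forall>i\<in>vertices G. 0 \<le> x i" "sum x (vertices G) = 1"
  shows "lagrange_poly r G x \<le> lagrangian r G"
  unfolding lagrangian_def
proof (rule cSup_upper)
  show "bdd_above {lagrange_poly r G x |x. (\<forall>i\<in>vertices G. 0 \<le> x i) \<and> sum x (vertices G) = 1}"
    using lagrange_poly_le_fact[OF assms(1)] by (intro bdd_aboveI[of _ "fact r"]) auto
qed (use assms in auto)

lemma lagrangian_le_fact:
  assumes "r_graph r G" "vertices G \<noteq> {}"
  shows "lagrangian r G \<le> fact r"
  unfolding lagrangian_def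
proof (rule cSup_least)
  obtain v where v: "v \<in> vertices G" using assms(2) by blast
  have "finite (vertices G)" using assms(1) by (simp add: r_graph_def)
  then have "sum (\<lambda>i. if i = v then 1 else 0 :: real) (vertices G) = 1" using v by simp
  then show "{lagrange_poly r G x |x. (\<forall>i\<in>vertices G. 0 \<le> x i) \<and> sum x (vertices G) = 1} \<noteq> {}"
    by (auto intro!: exI[of _ "\<lambda>i. if i = v then 1 else 0 :: real"])
qed (use lagrange_poly_le_fact[OF assms(1)] in auto)

lemma bdd_above_lagrangians:
  "bdd_above (insert 0 {lagrangian r G | G :: nat hypergraph. r_graph r G \<and> vertices G \<noteq> {} \<and> \<not> contains_copy G F})"
  by (rule bdd_aboveI[of _ "fact r"]) (auto intro!: lagrangian_le_fact)

lemma lagrangian_density_nonneg: "0 \<le> lagrangian_density r F"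
  unfolding lagrangian_density_def by (intro cSup_upper bdd_above_lagrangians) auto

lemma lagrangian_le_density:
  fixes G :: "nat hypergraph"
  assumes "r_graph r G" "vertices G \<noteq> {}" "\<not> contains_copy G F"
  shows "lagrangian r G \<le> lagrangian_density r F"
  unfolding lagrangian_density_def by (intro cSup_upper bdd_above_lagrangians) (use assms in auto)

section \<open>Cores and copies of \<open>F\<close>\<close>

lemma contains_core_imp_not_free:
  fixes G :: "'b hypergraph"
  assumes "r_graph r G" "C \<subseteq> vertices G" "card C = p" "contains_copy (induced G C) F"
    and "pairwise_covered (edges G) C"
  shows "\<not> family_free (K_family r F p :: 'b hypergraph set) G"
proof -
  have "G \<in> K_family r F p"
    using assms by (auto simp: K_family_def pairwise_covered_def covered_def)
  moreover have "contains_copy G G" unfolding contains_copy_def by (intro exI[of _ id]) auto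
  ultimately show ?thesis by (auto simp: family_free_def)
qed

lemma pairwise_covered_complete:
  assumes "nsets U r \<subseteq> \<E>" "finite U" "2 \<le> r" "r \<le> card U"
  shows "pairwise_covered \<E> U"
  unfolding pairwise_covered_def
proof (intro ballI impI)
  fix a b assume ab: "a \<in> U" "b \<in> U" "a \<noteq> b"
  then have "{a, b} \<subseteq> U" "card {a, b} \<le> r" using assms(3) by auto
  then obtain e where e: "{a, b} \<subseteq> e" "e \<subseteq> U" "card e = r"
    using exists_subset_between[of "{a, b}" r U] assms(2,4) by auto
  then have "e \<in> nsets U r" using finite_subset[OF e(2) assms(2)] by (simp add: nsets_def)
  then show "\<exists>e\<in>\<E>. a \<in> e \<and> b \<in> e" using assms(1) e(1) by blast
qed

text \<open>Lets the one edge at the vertex of degree 1, without that vertex, be sent onto a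
  prescribed subset of \<open>U\<close>.\<close>

lemma exists_inj_extending:
  assumes "finite A" "finite U" "card A \<le> card U" "A' \<subseteq> A" "U' \<subseteq> U" "card A' = card U'"
  obtains g where "inj_on g A" "g ` A \<subseteq> U" "g ` A' = U'"
proof -
  have fin: "finite A'" "finite U'" using assms finite_subset by auto
  obtain g1 where g1: "bij_betw g1 A' U'" using finite_same_card_bij[OF fin assms(6)] by blast
  have "card (A - A') \<le> card (U - U')"
    using assms fin by (simp add: card_Diff_subset)
  then obtain g2 where g2: "inj_on g2 (A - A')" "g2 ` (A - A') \<subseteq> U - U'"
    using inj_on_iff_card_le[of "A - A'" "U - U'"] assms by auto
  define g where "g = (\<lambda>a. if a \<in> A' then g1 a else g2 a)"
  have im1: "g ` A' = U'" using g1 by (auto simp: g_def bij_betw_def)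
  have im2: "g ` (A - A') \<subseteq> U - U'" using g2 by (auto simp: g_def)
  have "inj_on g A'" using g1 by (auto simp: g_def bij_betw_def inj_on_def)
  moreover have "inj_on g (A - A')" using g2 by (auto simp: g_def inj_on_def)
  ultimately have "inj_on g (A' \<union> (A - A'))"
    using im1 im2 by (subst inj_on_Un) blast
  then have "inj_on g A" using assms(4) by (simp add: Un_absorb1)
  moreover have "g ` A \<subseteq> U" using im1 im2 assms(5) by blast
  ultimately show thesis using that im1 by blast
qed

text \<open>Edges of \<open>F\<close> sent into the complete set \<open>U\<close> cause no
  constraint. If \<open>F\<close> has \<open>m + 1\<close> vertices, its vertex of degree 1 goes to
  \<open>y\<close>, and its only edge has to go to \<open>insert y f\<close>.\<close>

lemma contains_copy_core:
  assumes F: "r_graph r F" "2 \<le> r"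
    and card_F: "card (vertices F) \<le> m \<or> (card (vertices F) = m + 1 \<and> (\<exists>v\<in>vertices F. degree F v = 1))"
    and U: "finite U" "card U = m" "U \<subseteq> vertices G" "y \<in> vertices G" "y \<notin> U" "nsets U r \<subseteq> edges G"
    and f: "f \<subseteq> U" "insert y f \<in> edges G" "card (insert y f) = r"
  shows "contains_copy (induced G (insert y U)) F"
proof -
  let ?C = "insert y U"
  have finF: "finite (vertices F)" and edges_F: "\<And>e. e \<in> edges F \<Longrightarrow> e \<subseteq> vertices F \<and> card e = r"
    using F by (auto simp: r_graph_def)
  have in_U: "g ` e \<in> edges (induced G ?C)" if "e \<in> edges F" "inj_on g e" "g ` e \<subseteq> U" for g e
  proof -
    have "card (g ` e) = r" using card_image that edges_F by metis
    then have "g ` e \<in> nsets U r" using that finite_subset[OF that(3) U(1)] by (simp add: nsets_def)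
    then show ?thesis using U(6) that(3) by (auto simp: induced_def)
  qed
  have vC: "vertices (induced G ?C) = ?C" using U by (auto simp: induced_def)
  show ?thesis
  proof (cases "card (vertices F) \<le> m")
    case True
    then obtain g where g: "inj_on g (vertices F)" "g ` vertices F \<subseteq> U"
      using inj_on_iff_card_le[OF finF U(1)] U(2) by auto
    have "g ` e \<in> edges (induced G ?C)" if e: "e \<in> edges F" for e
    proof (rule in_U[OF e])
      have "e \<subseteq> vertices F" using edges_F e by auto
      then show "inj_on g e" "g ` e \<subseteq> U" using g inj_on_subset by blast+
    qed
    then show ?thesis unfolding contains_copy_def vC using g by blast
  next
    case False
    then obtain v where v: "card (vertices F) = m + 1" "v \<in> vertices F" "degree F v = 1"
      using card_F by auto
    then obtain e\<^sub>0 where e\<^sub>0: "{e \<in> edges F. v \<in> e} = {e\<^sub>0}"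
      unfolding degree_def by (auto simp: card_1_singleton_iff)
    then have e\<^sub>0': "e\<^sub>0 \<in> edges F" "v \<in> e\<^sub>0" by auto
    let ?A = "vertices F - {v}" and ?A' = "e\<^sub>0 - {v}"
    have fin_f: "finite f" using f(1) U(1) finite_subset by blast
    have "card ?A' = card f"
      using e\<^sub>0' edges_F[OF e\<^sub>0'(1)] f U(5) fin_f by (auto simp: card_insert_if)
    moreover have "?A' \<subseteq> ?A" using edges_F[OF e\<^sub>0'(1)] by auto
    moreover have "card ?A \<le> card U" using v finF U by simp
    ultimately obtain g where g: "inj_on g ?A" "g ` ?A \<subseteq> U" "g ` ?A' = f"
      using exists_inj_extending[of ?A U ?A' f] finF U(1) f(1) by blast
    define h where "h = g(v := y)"
    have h_A: "h ` S = g ` S" if "v \<notin> S" for S using that by (auto simp: h_def)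
    have inj_A: "inj_on h ?A" using g(1) by (auto simp: h_def inj_on_def)
    have h_img: "h ` ?A \<subseteq> U" using h_A[of ?A] g(2) by simp
    have "h v \<notin> h ` ?A" using h_img U(5) by (auto simp: h_def)
    then have "inj_on h (insert v ?A)" unfolding inj_on_insert using inj_A by simp
    then have inj: "inj_on h (vertices F)" by (simp only: insert_Diff[OF v(2)])
    have "h ` vertices F \<subseteq> ?C" using h_img by (auto simp: h_def)
    moreover have "h ` e \<in> edges (induced G ?C)" if e: "e \<in> edges F" for e
    proof (cases "v \<in> e")
      case True
      then have "e = e\<^sub>0" using e\<^sub>0 e by auto
      then have "e = insert v ?A'" using e\<^sub>0'(2) by auto
      then have "h ` e = insert (h v) (h ` ?A')" by blast
      then have "h ` e = insert y f" using h_A[of ?A'] g(3) by (simp add: h_def)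
      then show ?thesis using f by (auto simp: induced_def)
    next
      case False
      then have sub: "e \<subseteq> ?A" using edges_F[OF e] by auto
      show ?thesis
        by (rule in_U[OF e]) (use sub inj_A h_img inj_on_subset in blast)+
    qed
    ultimately show ?thesis unfolding contains_copy_def vC using inj by blast
  qed
qed

lemma free_imp_coreless:
  fixes F :: "'a hypergraph" and G :: "nat hypergraph"
  assumes "2 \<le> r" "r \<le> m" "r_graph r F"
    and card_F: "card (vertices F) \<le> m \<or> (card (vertices F) = m + 1 \<and> (\<exists>v\<in>vertices F. degree F v = 1))"
    and dens: "lagrangian_density r F < turan_density m r"
    and G: "r_graph r G" "family_free (K_family r F (m + 1) :: nat hypergraph set) G"
  shows "coreless (vertices G) (edges G) m r (lagrangian_density r F)"
proof
  have fin: "finite (vertices G)" and edges: "\<And>e. e \<in> edges G \<Longrightarrow> e \<subseteq> vertices G \<and> card e = r"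
    using G(1) by (auto simp: r_graph_def)
  show "finite (vertices G)" by (rule fin)
  show "e \<subseteq> vertices G \<and> card e = r" if "e \<in> edges G" for e using edges that by blast
  show "\<exists>u\<in>U. \<forall>e\<in>edges G. \<not> (u \<in> e \<and> y \<in> e)"
    if U: "U \<subseteq> vertices G" "card U = m" "nsets U r \<subseteq> edges G" "y \<in> vertices G" "y \<notin> U"
      and f: "f \<subseteq> U" "insert y f \<in> edges G" for U y f
  proof (rule ccontr)
    assume "\<not> ?thesis"
    then have cov: "\<exists>e\<in>edges G. u \<in> e \<and> y \<in> e" if "u \<in> U" for u using that by blast
    have finU: "finite U" using U(1) fin by (rule finite_subset)
    have "pairwise_covered (edges G) U"
      using U finU assms by (intro pairwise_covered_complete) auto
    then have "pairwise_covered (edges G) (insert y U)"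
      using cov unfolding pairwise_covered_def by blast
    moreover have "contains_copy (induced G (insert y U)) F"
      using contains_copy_core[OF assms(3,1) card_F finU U(2,1,4,5,3) f] edges[OF f(2)] by blast
    moreover have "insert y U \<subseteq> vertices G" "card (insert y U) = m + 1" using U finU by auto
    ultimately show False using contains_core_imp_not_free[OF G(1)] G(2) by blast
  qed
  show "fact r * wt x {e \<in> edges G. e \<subseteq> S} \<le> lagrangian_density r F"
    if S: "S \<subseteq> vertices G" "m < card S" "pairwise_covered (edges G) S" and x: "\<And>i. 0 \<le> x i" "sum x S = 1"
    for S x
  proof -
    have vS: "vertices (induced G S) = S" "edges (induced G S) = {e \<in> edges G. e \<subseteq> S}"
      using S(1) by (auto simp: induced_def)
    have finS: "finite S" using S(1) fin by (rule finite_subset)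
    have rS: "r_graph r (induced G S)" using vS finS edges by (auto simp: r_graph_def)
    have "\<not> contains_copy (induced G S) F"
    proof
      assume "contains_copy (induced G S) F"
      then obtain h where h: "inj_on h (vertices F)" "h ` vertices F \<subseteq> S"
        "\<And>e. e \<in> edges F \<Longrightarrow> h ` e \<in> edges G"
        unfolding contains_copy_def vS by auto
      have "card (h ` vertices F) \<le> m + 1" using card_F card_image[OF h(1)] by auto
      \<comment> \<open>Cores have exactly \<open>m + 1\<close> vertices, so \<open>S\<close> is cut
        down. Covering edges are taken in \<open>G\<close> and may leave \<open>C\<close>, so pairs
        in \<open>C\<close> stay covered.\<close>
      then obtain C where C: "h ` vertices F \<subseteq> C" "C \<subseteq> S" "card C = m + 1"
        using exists_subset_between[of "h ` vertices F" "m + 1" S] h(2) S(2) finS by auto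
      have "contains_copy (induced G C) F"
        unfolding contains_copy_def
      proof (intro exI[of _ h] conjI ballI)
        show "h ` vertices F \<subseteq> vertices (induced G C)" using C S(1) by (auto simp: induced_def)
        fix e assume e: "e \<in> edges F"
        then have "e \<subseteq> vertices F" using assms(3) by (auto simp: r_graph_def)
        then have "h ` e \<subseteq> C" using C(1) by blast
        then show "h ` e \<in> edges (induced G C)" using h(3)[OF e] by (simp add: induced_def)
      qed (rule h(1))
      moreover have "pairwise_covered (edges G) C" using S(3) C(2) unfolding pairwise_covered_def by blast
      moreover have "C \<subseteq> vertices G" using C(2) S(1) by blast
      ultimately show False using contains_core_imp_not_free[OF G(1)] G(2) C(3) by blast
    qed
    moreover have "S \<noteq> {}" using S(2) by auto
    ultimately have "lagrangian r (induced G S) \<le> lagrangian_density r F"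
      using rS vS by (intro lagrangian_le_density) auto
    moreover have "lagrange_poly r (induced G S) x \<le> lagrangian r (induced G S)"
      using rS vS x by (intro lagrange_poly_le_lagrangian) auto
    ultimately show ?thesis by (simp add: lagrange_poly_wt vS)
  qed
qed (use assms in auto)

section \<open>From edge density to uniform weights\<close>

lemma turan_density_ge:
  assumes "r \<le> n" "0 < n"
  shows "1 - real r ^ 2 / real n \<le> turan_density n r"
proof -
  have "k \<le> r \<Longrightarrow> 1 - real k * (real r / real n) \<le> (\<Prod>i<k. (real n - real i) / real n) \<and>
      (\<Prod>i<k. (real n - real i) / real n) \<le> 1" for k
  proof (induction k)
    case (Suc k)
    let ?p = "\<Prod>i<k. (real n - real i) / real n" and ?b = "(real n - real k) / real n"
    have b: "0 \<le> ?b" "?b \<le> 1" "1 - real r / real n \<le> ?b"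
      using Suc.prems assms by (auto simp: field_simps)
    have p: "1 - real k * (real r / real n) \<le> ?p" "?p \<le> 1" using Suc by auto
    have p0: "0 \<le> ?p" using Suc.prems assms by (intro prod_nonneg) auto
    \<comment> \<open>For numbers in the unit interval the losses from \<open>1\<close> add up at
      most; this is why the induction also carries the bound by \<open>1\<close>.\<close>
    have "0 \<le> (1 - ?p) * (1 - ?b)" using p b by (intro mult_nonneg_nonneg) auto
    then have "?p + ?b - 1 \<le> ?p * ?b" by (simp add: algebra_simps)
    moreover have "real (Suc k) * (real r / real n) = real k * (real r / real n) + real r / real n"
      by (simp only: of_nat_Suc distrib_right mult_1 add.commute)
    ultimately have "1 - real (Suc k) * (real r / real n) \<le> ?p * ?b" using p(1) b(3) by linarith
    moreover have "?p * ?b \<le> 1" using p p0 b by (intro mult_le_one) auto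
    ultimately show ?case by (simp only: prod.lessThan_Suc)
  qed simp
  from this[of r] show ?thesis by (simp add: turan_density_prod power2_eq_square)
qed

lemma card_scaled_eq_wt:
  assumes "r_graph r G"
  shows "wt (\<lambda>_. 1 / real n) (edges G) = real (card (edges G)) / real n ^ r"
proof -
  have "wt (\<lambda>_. 1 / real n) (edges G) = (\<Sum>e\<in>edges G. 1 / real n ^ r)"
    unfolding wt_def using assms by (intro sum.cong) (auto simp: r_graph_def power_one_over)
  then show ?thesis by simp
qed

text \<open>Passing from \<open>n choose r\<close> to \<open>n ^ r / fact r\<close> loses a factor
  \<open>1 - real r ^ 2 / real n\<close>, which accounts for the second \<delta>.\<close>

lemma dense_imp_wt_ge:
  assumes "r_graph r G" "r \<le> n" "0 < n" "0 \<le> \<mu> - \<delta>" "\<mu> - \<delta> \<le> 1" "real r ^ 2 / real n \<le> \<delta>"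
    and "(\<mu> - \<delta>) * real (n choose r) < real (card (edges G))"
  shows "(\<mu> - 2 * \<delta>) / fact r \<le> wt (\<lambda>_. 1 / real n) (edges G)"
proof -
  have "\<mu> - 2 * \<delta> \<le> (\<mu> - \<delta>) - (\<mu> - \<delta>) * (real r ^ 2 / real n)"
    using mult_left_le_one_le[of "real r ^ 2 / real n" "\<mu> - \<delta>"] assms by simp
  also have "\<dots> = (\<mu> - \<delta>) * (1 - real r ^ 2 / real n)" by (simp add: algebra_simps)
  also have "\<dots> \<le> (\<mu> - \<delta>) * turan_density n r"
    using turan_density_ge assms by (intro mult_left_mono) auto
  finally have "(\<mu> - 2 * \<delta>) / fact r \<le> (\<mu> - \<delta>) * (turan_density n r / fact r)"
    by (simp add: divide_right_mono)
  also have "\<dots> = (\<mu> - \<delta>) * real (n choose r) * (1 / real n) ^ r"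
    by (simp flip: turan_density_choose)
  also have "\<dots> \<le> real (card (edges G)) * (1 / real n) ^ r"
    using assms(7) by (intro mult_right_mono) auto
  finally show ?thesis using card_scaled_eq_wt[OF assms(1), of n] by (simp add: power_one_over)
qed

theorem theorem6p2:
  fixes m r :: nat and F :: "'a hypergraph"
  assumes "m \<ge> 2" and "r \<ge> 2"
    and "r_graph r F"
    and "card (vertices F) \<le> m \<or>
         (card (vertices F) = m + 1 \<and> (\<exists>v\<in>vertices F. degree F v = 1))"
    and "lagrangian_density r F < falling_factorial m r / real m ^ r"
  shows "m_stable r m (K_family r F (m + 1) :: nat hypergraph set)"
  unfolding m_stable_def
proof (intro allI impI)
  fix \<epsilon>\<^sub>0 :: real assume "0 < \<epsilon>\<^sub>0"
  let ?\<mu> = "turan_density m r" and ?\<rho> = "lagrangian_density r F"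
  have dens: "?\<rho> < ?\<mu>" using assms(5) by (simp add: turan_density_def)
  \<comment> \<open>For \<open>m < r\<close> the bound \<mu> is \<open>0\<close>, and no nonnegative
    density lies strictly below it.\<close>
  have r_le: "r \<le> m"
    using dens lagrangian_density_nonneg[of r F] turan_density_eq_0[of m r] by (cases "m < r") auto
  \<comment> \<open>The constant \<open>\<sigma>\<^sub>0\<close> depends on \<open>m\<close> and \<open>r\<close> only; its positivity comes from the empty instance.\<close>
  interpret empty: coreless "{} :: nat set" "{}" m r ?\<rho>
    by unfold_locales (use assms r_le dens in auto)
  let ?C = "2 * real r ^ 2 + 3 * fact r"
  have C: "0 < ?C" by (simp add: add_nonneg_pos)
  \<comment> \<open>The middle two bounds meet the smallness conditions of \<open>stable_at\<close>;
    the last one, with \<open>\<epsilon>\<^sup>2 \<le> \<epsilon>\<close>, keeps the Lagrangian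
    density below \<open>?\<mu> - \<epsilon>\<^sup>2\<close>.\<close>
  let ?bounds = "{\<epsilon>\<^sub>0, 1 / 2, empty.\<sigma>\<^sub>0 / ?C, (?\<mu> - ?\<rho>) / 2}"
  define \<epsilon> where "\<epsilon> = Min ?bounds"
  have "\<forall>b\<in>?bounds. 0 < b" using \<open>0 < \<epsilon>\<^sub>0\<close> empty.\<sigma>\<^sub>0_pos C dens by auto
  then have "0 < \<epsilon>" unfolding \<epsilon>_def by (subst Min_gr_iff) auto
  moreover have "\<epsilon> \<le> b" if "b \<in> ?bounds" for b unfolding \<epsilon>_def by (rule Min_le) (use that in auto)
  then have "\<epsilon> \<le> \<epsilon>\<^sub>0" "\<epsilon> \<le> 1 / 2" "\<epsilon> \<le> empty.\<sigma>\<^sub>0 / ?C" "\<epsilon> \<le> (?\<mu> - ?\<rho>) / 2" by blast+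
  ultimately have \<epsilon>: "0 < \<epsilon>" "\<epsilon> \<le> \<epsilon>\<^sub>0" "\<epsilon> < 1" "\<epsilon> \<le> empty.\<sigma>\<^sub>0 / ?C" "\<epsilon> \<le> (?\<mu> - ?\<rho>) / 2"
    by auto
  have \<epsilon>_\<sigma>: "?C * \<epsilon> \<le> empty.\<sigma>\<^sub>0" using \<epsilon>(4) C by (simp add: field_simps)
  have sq: "\<epsilon>\<^sup>2 \<le> \<epsilon>" using \<epsilon> by (simp add: power2_eq_square mult_left_le)
  \<comment> \<open>The uniform weights lose \<open>2 * \<delta>\<close>, and
    \<open>stable_at\<close> tolerates a loss of \<open>\<epsilon>\<^sup>2\<close>.\<close>
  define \<delta> where "\<delta> = \<epsilon>\<^sup>2 / 2"
  have \<delta>: "0 < \<delta>" "2 * \<delta> = \<epsilon>\<^sup>2" using \<epsilon> by (auto simp: \<delta>_def)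
  have "\<delta> \<le> ?\<mu>" using \<delta>(2) sq \<epsilon>(5) dens lagrangian_density_nonneg[of r F] by argo
  then have \<mu>\<delta>: "0 \<le> ?\<mu> - \<delta>" "?\<mu> - \<delta> \<le> 1"
    using \<delta>(1) turan_density_le_1[of m r] by simp_all
  show "\<exists>\<delta>>0. \<exists>n\<^sub>1. \<forall>G :: nat hypergraph. r_graph r G \<and> family_free (K_family r F (m + 1) :: nat hypergraph set) G \<and>
      n\<^sub>1 \<le> card (vertices G) \<and>
      (falling_factorial m r / real m ^ r - \<delta>) * real (card (vertices G) choose r) < real (card (edges G)) \<longrightarrow>
      (\<exists>S\<subseteq>vertices G. real (card S) \<le> \<epsilon>\<^sub>0 * real (card (vertices G)) \<and> m_partite m (delete_vertices G S))"
  \<comment> \<open>This threshold guarantees both that \<open>r\<close> is at most the number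
    \<open>n\<close> of vertices and that \<open>real r ^ 2 / real n\<close> is at most
    \<delta>.\<close>
  proof (rule exI[of _ \<delta>], intro conjI \<delta>(1), rule exI[of _ "r + nat \<lceil>real r ^ 2 / \<delta>\<rceil>"], intro allI impI, elim conjE)
    fix G :: "nat hypergraph"
    let ?V = "vertices G"
    let ?n = "card ?V"
    assume G: "r_graph r G" "family_free (K_family r F (m + 1) :: nat hypergraph set) G"
      and n: "r + nat \<lceil>real r ^ 2 / \<delta>\<rceil> \<le> ?n"
      and e: "(falling_factorial m r / real m ^ r - \<delta>) * real (?n choose r) < real (card (edges G))"
    interpret coreless ?V "edges G" m r ?\<rho>
      by (rule free_imp_coreless[OF assms(2) r_le assms(3,4) dens G])
    let ?x = "\<lambda>_ :: nat. 1 / real ?n"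
    have n': "r \<le> ?n" "0 < ?n" using n assms(2) by auto
    have "real r ^ 2 / \<delta> \<le> real ?n" using n by linarith
    then have "real r ^ 2 / real ?n \<le> \<delta>" using n' \<delta> by (simp add: field_simps)
    then have "(?\<mu> - 2 * \<delta>) / fact r \<le> wt ?x (edges G)"
      using dense_imp_wt_ge[OF G(1) n' \<mu>\<delta>] e by (simp add: turan_density_def)
    moreover have "prob ?x" using n' by simp
    ultimately have "stable_at \<epsilon> ?x"
      using \<epsilon> \<epsilon>_\<sigma> sq dens \<delta>(2) by (intro stable_at) auto
    then obtain S where S: "S \<subseteq> ?V" "partite_on S" "sum ?x (?V - S) \<le> \<epsilon>"
      unfolding stable_at_def by blast
    have "real (card (?V - S)) \<le> \<epsilon> * real ?n" using S(3) n' by (simp add: field_simps)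
    also have "\<dots> \<le> \<epsilon>\<^sub>0 * real ?n" using \<epsilon> by (intro mult_right_mono) auto
    finally have small: "real (card (?V - S)) \<le> \<epsilon>\<^sub>0 * real ?n" .
    have "?V - (?V - S) = S" using S(1) by blast
    then have "vertices (delete_vertices G (?V - S)) = S"
      "edges (delete_vertices G (?V - S)) = {e \<in> edges G. e \<subseteq> S}"
      using S(1) by (auto simp: delete_vertices_def induced_def)
    then have "m_partite m (delete_vertices G (?V - S))"
      using S(2) unfolding m_partite_def partite_on_def by auto
    with small show "\<exists>S\<subseteq>?V. real (card S) \<le> \<epsilon>\<^sub>0 * real ?n \<and> m_partite m (delete_vertices G S)"
      by (intro exI[of _ "?V - S"]) auto
  qed
qed

end
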